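(* Let $X$ be a continuum (a compact connected Hausdorff space, not necessarily metrizable). Then there exist a hereditarily indecomposable continuum $Y$ with $\dim Y = 1$ and weight equal to the weight of $X$, and a continuous surjection $f:Y\to X$ that is weakly confluent.
   Context: A compact Hausdorff space is called hereditarily indecomposable if whenever two subcontinua of it meet, one of them is contained in the other. A continuous surjection $f:Y\to X$ is weakly confluent if every subcontinuum of $X$ is the image under $f$ of some subcontinuum of $Y$. $\dim$ denotes covering dimension. *)

theory Defs
  imports "HOL-Analysis.Analysis"
begin

definition continuum :: "'a topology \<Rightarrow> bool" where
  "continuum X \<longleftrightarrow> topspace X \<noteq> {} \<and> compact_space X \<and> connected_space X \<and> Hausdorff_space X"

definition subcontinuum :: "'a topology \<Rightarrow> 'a set \<Rightarrow> bool" where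
  "subcontinuum X C \<longleftrightarrow> C \<subseteq> topspace X \<and> C \<noteq> {} \<and> compactin X C \<and> connectedin X C"

definition hereditarily_indecomposable :: "'a topology \<Rightarrow> bool" where
  "hereditarily_indecomposable X \<longleftrightarrow> compact_space X \<and> Hausdorff_space X \<and>
     (\<forall>A B. subcontinuum X A \<and> subcontinuum X B \<and> A \<inter> B \<noteq> {} \<longrightarrow> A \<subseteq> B \<or> B \<subseteq> A)"

definition weakly_confluent :: "'a topology \<Rightarrow> 'b topology \<Rightarrow> ('a \<Rightarrow> 'b) \<Rightarrow> bool" where
  "weakly_confluent Y X f \<longleftrightarrow> continuous_map Y X f \<and> f ` topspace Y = topspace X \<and>
     (\<forall>K. subcontinuum X K \<longrightarrow> (\<exists>L. subcontinuum Y L \<and> f ` L = K))"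

definition covering_dim_le :: "'a topology \<Rightarrow> nat \<Rightarrow> bool" where
  "covering_dim_le X n \<longleftrightarrow>
     (\<forall>\<U>. finite \<U> \<and> (\<forall>U\<in>\<U>. openin X U) \<and> \<Union>\<U> = topspace X \<longrightarrow>
        (\<exists>\<V>. finite \<V> \<and> (\<forall>V\<in>\<V>. openin X V) \<and> \<Union>\<V> = topspace X \<and>
             (\<forall>V\<in>\<V>. \<exists>U\<in>\<U>. V \<subseteq> U) \<and>
             (\<forall>x\<in>topspace X. card {V\<in>\<V>. x \<in> V} \<le> n + 1)))"

definition covering_dim_eq :: "'a topology \<Rightarrow> nat \<Rightarrow> bool" where
  "covering_dim_eq X n \<longleftrightarrow> covering_dim_le X n \<and> (\<forall>m<n. \<not> covering_dim_le X m)"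

definition open_base :: "'a topology \<Rightarrow> 'a set set \<Rightarrow> bool" where
  "open_base X \<B> \<longleftrightarrow> (\<forall>B\<in>\<B>. openin X B) \<and>
     (\<forall>U. openin X U \<longrightarrow> (\<exists>\<S>\<subseteq>\<B>. \<Union>\<S> = U))"

text \<open>Weight (with the standard convention that weight is at least aleph_0):
  w(X) \<le> w(Y) iff for every base of Y there is a base of X of cardinality \<le> that of the
  given base plus aleph_0.\<close>
definition weight_le :: "'a topology \<Rightarrow> 'b topology \<Rightarrow> bool" where
  "weight_le X Y \<longleftrightarrow> (\<forall>\<B>. open_base Y \<B> \<longrightarrow>
     (\<exists>\<C>. open_base X \<C> \<and> ordLeq3 (card_of \<C>) (card_of (\<B> <+> (UNIV :: nat set)))))"

definition same_weight :: "'a topology \<Rightarrow> 'b topology \<Rightarrow> bool" where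
  "same_weight X Y \<longleftrightarrow> weight_le X Y \<and> weight_le Y X"

end

theory Submission
  imports Defs
begin

text \<open>
  \<open>Y\<close> is a component of a closed subset \<open>M\<close> of \<open>X\<close> times a product of copies of the cube
  \<open>[0,1]\<^sup>\<omega>\<close>, where the coordinates are arranged in \<open>\<omega>\<close> stages and each coordinate is tied by
  one equation to the earlier ones. There are two kinds of equations. The first replaces a point
  lying in the members \<open>F\<^sub>i\<close> (\<open>i \<in> S\<close>) of a finite closed cover by the complete graph with vertex
  set \<open>S\<close>: the fibres are connected, and the open stars of the vertices form a refinement of order
  two. The second pulls back the path with vertices 0, 1, 2, folded so that the passage 0-1 happens
  over the frontier of \<open>V\<close> and the passage 1-2 over the frontier of \<open>U\<close>; this is the crookedness
  criterion of Krasinkiewicz and Minc and forces hereditary indecomposability. Running through all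
  finite covers and all pairs of basic boxes does not increase the weight.

  Weak confluence comes from counting modulo 2: the fold has an odd number of sheets, so there is an
  additive transfer from clopen subsets of \<open>M\<close> over a closed set \<open>K\<close> to clopen subsets of \<open>K\<close> that
  sends everything to \<open>K\<close>. Over a connected set, one piece of every clopen partition therefore
  has odd degree, and by compactness some component of \<open>M\<close> contains lifts of all
  subcontinua. A one-point \<open>X\<close> is handled by mapping a preimage of \<open>[0,1]\<close> to the point.
\<close>

section \<open>Lifting subcontinua through clopen partitions\<close>

lemma disjoint_family_Int_eq_Diff:
  assumes "pairwise disjnt \<O>" "G \<in> \<O>" "S \<subseteq> \<Union>\<O>"
  shows "S \<inter> G = S - \<Union>(\<O> - {G})"
proof -
  have "G \<inter> H = {}" if "H \<in> \<O> - {G}" for H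
    using assms(1,2) that unfolding pairwise_def disjnt_def by (metis DiffD1 DiffD2 singletonI)
  then show ?thesis using assms(3) by blast
qed

text \<open>\<open>\<Phi> A\<close> stands for the set of points over which \<open>A\<close> has odd degree.\<close>

locale transfer =
  fixes Q :: "'q topology" and X :: "'a topology" and p :: "'q \<Rightarrow> 'a" and Z :: "'q set"
    and \<Phi> :: "'q set \<Rightarrow> 'a set"
  assumes Un: "\<And>A B. A \<inter> B = {} \<Longrightarrow> \<Phi> (A \<union> B) = (\<Phi> A - \<Phi> B) \<union> (\<Phi> B - \<Phi> A)"
    and image: "\<And>A. \<Phi> A \<subseteq> p ` A"
    and total: "topspace X \<subseteq> \<Phi> Z"
    and closed: "\<And>K A B. \<lbrakk>closedin X K; closedin Q A; closedin Q B; A \<inter> B = {}; A \<union> B = Z \<inter> p -` K\<rbrakk>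
      \<Longrightarrow> closedin X (\<Phi> A)"

lemma transfer_empty: "transfer Q X p Z \<Phi> \<Longrightarrow> \<Phi> {} = {}"
  using transfer.image by fastforce

text \<open>Split \<open>A\<close> into its part over \<open>K\<close> and its part off
  \<open>K\<close>. By \<open>image\<close> the odd-degree sets of these parts lie inside
  \<open>K\<close> and outside \<open>K\<close>, so additivity separates them.\<close>

lemma transfer_Int_vimage:
  assumes "transfer Q X p Z \<Phi>"
  shows "\<Phi> (A \<inter> p -` K) = \<Phi> A \<inter> K"
proof -
  have "A = (A \<inter> p -` K) \<union> (A - p -` K)" "(A \<inter> p -` K) \<inter> (A - p -` K) = {}" by auto
  then have eq: "\<Phi> A = (\<Phi> (A \<inter> p -` K) - \<Phi> (A - p -` K)) \<union> (\<Phi> (A - p -` K) - \<Phi> (A \<inter> p -` K))"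
    using transfer.Un[OF assms] by metis
  have "\<Phi> (A \<inter> p -` K) \<subseteq> K" "\<Phi> (A - p -` K) \<inter> K = {}"
    using transfer.image[OF assms, of "A \<inter> p -` K"] transfer.image[OF assms, of "A - p -` K"] by auto
  then show ?thesis using eq by blast
qed

text \<open>The closedness axiom applies to \<open>A\<close> and to its complement \<open>B\<close>.
  Their odd-degree sets are closed subsets of \<open>K\<close> whose symmetric difference is all of
  \<open>K\<close>, so they partition \<open>K\<close>, and connectedness makes one of them
  empty.\<close>

lemma transfer_clopen_cases:
  assumes T: "transfer Q X p Z \<Phi>" and K: "closedin X K" "connectedin X K"
    and A: "closedin Q A" "closedin Q B" "A \<inter> B = {}" "A \<union> B = Z \<inter> p -` K"
  shows "\<Phi> A = {} \<or> \<Phi> A = K"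
proof -
  have cl: "closedin X (\<Phi> A)" "closedin X (\<Phi> B)"
    using transfer.closed[OF T K(1)] A by (auto simp: Int_commute Un_commute)
  have sub: "K \<subseteq> topspace X" using K closedin_subset by blast
  have "\<Phi> (A \<union> B) = \<Phi> Z \<inter> K" using A transfer_Int_vimage[OF T] by simp
  also have "\<dots> = K" using transfer.total[OF T] sub by blast
  finally have eq: "(\<Phi> A - \<Phi> B) \<union> (\<Phi> B - \<Phi> A) = K" using transfer.Un[OF T A(3)] by simp
  have "\<Phi> A \<subseteq> K" "\<Phi> B \<subseteq> K"
    using transfer.image[OF T, of A] transfer.image[OF T, of B] A by auto
  with eq have "\<Phi> A \<inter> \<Phi> B = {}" "\<Phi> A \<union> \<Phi> B = K" by blast+
  moreover have "\<not> (\<exists>E1 E2. closedin X E1 \<and> closedin X E2 \<and> K \<subseteq> E1 \<union> E2 \<and> E1 \<inter> E2 \<inter> K = {} \<and> E1 \<inter> K \<noteq> {} \<and> E2 \<inter> K \<noteq> {})"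
    using K(2) unfolding connectedin_closedin by (rule conjunct2)
  ultimately have "\<Phi> A \<inter> K = {} \<or> \<Phi> B \<inter> K = {}"
    using cl by (metis Int_assoc Int_empty_left subset_refl)
  then show ?thesis using \<open>\<Phi> A \<union> \<Phi> B = K\<close> by blast
qed

lemma transfer_Union_empty:
  assumes T: "transfer Q X p Z \<Phi>" and fin: "finite \<G>" and dis: "pairwise disjnt \<G>"
    and e: "\<And>G. G \<in> \<G> \<Longrightarrow> \<Phi> (A \<inter> G) = {}"
  shows "\<Phi> (A \<inter> \<Union>\<G>) = {}"
  using fin dis e
proof (induction \<G>)
  case empty
  then show ?case using transfer_empty[OF T] by simp
next
  case (insert P \<G>)
  have "A \<inter> \<Union>(insert P \<G>) = (A \<inter> P) \<union> (A \<inter> \<Union>\<G>)" by auto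
  moreover have "(A \<inter> P) \<inter> (A \<inter> \<Union>\<G>) = {}"
  proof -
    have "P \<inter> H = {}" if "H \<in> \<G>" for H
      using insert.hyps insert.prems(1) that unfolding pairwise_def disjnt_def by (metis insertCI)
    then show ?thesis by blast
  qed
  moreover have "\<Phi> (A \<inter> \<Union>\<G>) = {}"
    using insert by (simp add: pairwise_insert)
  ultimately show ?case
    using transfer.Un[OF T, of "A \<inter> P" "A \<inter> \<Union>\<G>"] insert.prems(2) by simp
qed

text \<open>A certificate that no connected subset of \<open>P\<close> maps onto \<open>K\<close>:
  such a set would lie in a single member of \<open>\<G>\<close>, whose image does not cover
  \<open>K\<close>. Being phrased with finitely many open sets, the certificate extends from a
  component to a neighbourhood of it.\<close>

definition lifting_obstruction :: "'q topology \<Rightarrow> 'a topology \<Rightarrow> ('q \<Rightarrow> 'a) \<Rightarrow> 'q set \<Rightarrow> bool" where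
  "lifting_obstruction Q X p P \<longleftrightarrow>
     (\<exists>K \<G>. subcontinuum X K \<and> finite \<G> \<and> pairwise disjnt \<G> \<and>
        (\<forall>G\<in>\<G>. openin Q G \<and> \<not> K \<subseteq> p ` G) \<and> P \<inter> p -` K \<subseteq> \<Union>\<G>)"

lemma lifting_obstruction_mono:
  "lifting_obstruction Q X p P \<Longrightarrow> P' \<subseteq> P \<Longrightarrow> lifting_obstruction Q X p P'"
  unfolding lifting_obstruction_def by (meson Int_mono order_refl order_trans)

text \<open>If \<open>\<Phi> A\<close> were nonempty it would be all of the connected space
  \<open>X\<close>. Over \<open>K\<close>, however, \<open>A\<close> splits into clopen pieces; each
  has odd degree over all of \<open>K\<close> or nowhere, and the former fails because its image
  misses a point of \<open>K\<close>. Adding up, \<open>\<Phi> A\<close> misses the nonempty set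
  \<open>K\<close>.\<close>

lemma transfer_obstructed:
  assumes T: "transfer Q X p Z \<Phi>" and X: "connected_space X" "Hausdorff_space X"
    and p: "continuous_map Q X p" and Z: "closedin Q Z"
    and A: "closedin Q A" "closedin Q (Z - A)" "A \<subseteq> Z" "lifting_obstruction Q X p A"
  shows "\<Phi> A = {}"
proof (rule ccontr)
  assume ne: "\<Phi> A \<noteq> {}"
  have Zt: "p ` Z \<subseteq> topspace X"
    using p Z closedin_subset continuous_map_image_subset_topspace by fastforce
  have "\<Phi> A = {} \<or> \<Phi> A = topspace X"
    by (rule transfer_clopen_cases[OF T, of _ _ "Z - A"]) (use X A Zt in \<open>auto simp: connectedin_topspace\<close>)
  with ne have top: "\<Phi> A = topspace X" by blast
  obtain K \<G> where K: "subcontinuum X K" and \<G>: "finite \<G>" "pairwise disjnt \<G>"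
      "\<And>G. G \<in> \<G> \<Longrightarrow> openin Q G" "\<And>G. G \<in> \<G> \<Longrightarrow> \<not> K \<subseteq> p ` G" and sub: "A \<inter> p -` K \<subseteq> \<Union>\<G>"
    using A(4) unfolding lifting_obstruction_def by blast
  have Kc: "closedin X K" "connectedin X K" "K \<subseteq> topspace X" "K \<noteq> {}"
    using K X compactin_imp_closedin unfolding subcontinuum_def by auto
  have clo: "closedin Q (S \<inter> p -` K)" if "closedin Q S" for S
  proof -
    have "S \<inter> p -` K = S \<inter> {x \<in> topspace Q. p x \<in> K}" using closedin_subset[OF that] by auto
    then show ?thesis
      using that closedin_continuous_map_preimage[OF p Kc(1)] by (simp add: closedin_Int)
  qed
  have "\<Phi> ((A \<inter> p -` K) \<inter> G) = {}" if G: "G \<in> \<G>" for G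
  proof -
    \<comment> \<open>These are complementary in \<open>Z\<close> over \<open>K\<close>. The piece
      \<open>?A\<close> is closed because it arises from the part of \<open>A\<close> over
      \<open>K\<close> by removing the other members of \<open>\<G>\<close>.\<close>
    let ?A = "(A \<inter> p -` K) \<inter> G" and ?B = "((Z - A) \<inter> p -` K) \<union> ((A \<inter> p -` K) - G)"
    have "?A = (A \<inter> p -` K) - \<Union>(\<G> - {G})"
      using disjoint_family_Int_eq_Diff[OF \<G>(2) G sub] by simp
    then have 1: "closedin Q ?A"
      using clo[OF A(1)] \<G>(3) by (metis DiffD1 closedin_diff openin_Union)
    have 2: "closedin Q ?B"
      using clo[OF A(1)] clo[OF A(2)] \<G>(3)[OF G] by (simp add: closedin_Un closedin_diff)
    have "\<Phi> ?A = {} \<or> \<Phi> ?A = K"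
      by (rule transfer_clopen_cases[OF T Kc(1,2) 1 2]) (use A in auto)
    moreover have "\<Phi> ?A \<noteq> K"
      using transfer.image[OF T, of ?A] \<G>(4)[OF G] by auto
    ultimately show ?thesis by blast
  qed
  then have "\<Phi> ((A \<inter> p -` K) \<inter> \<Union>\<G>) = {}"
    using transfer_Union_empty[OF T \<G>(1,2)] by blast
  then have "\<Phi> (A \<inter> p -` K) = {}" using sub by (simp add: inf.absorb1)
  then show False using transfer_Int_vimage[OF T, of A K] top Kc by auto
qed

section \<open>Clopen pieces of closed sets in compact Hausdorff spaces\<close>

text \<open>Compactness gives finitely many of the local sets \<open>P\<close>. They are made
  disjoint one at a time: the part of \<open>A\<close> already covered and the new remainder are
  disjoint closed sets, hence have disjoint open neighbourhoods, and shrinking to these preserves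
  the hereditary property \<open>R\<close>.\<close>

lemma finite_disjoint_open_cover:
  assumes Q: "compact_space Q" "Hausdorff_space Q" and A: "closedin Q A"
    and mono: "\<And>P P'. R P \<Longrightarrow> P' \<subseteq> P \<Longrightarrow> R P'"
    and loc: "\<And>a. a \<in> A \<Longrightarrow> \<exists>P. openin Q P \<and> a \<in> P \<and> R P \<and> closedin Q (A \<inter> P)"
  shows "\<exists>\<G>. finite \<G> \<and> pairwise disjnt \<G> \<and> (\<forall>G\<in>\<G>. openin Q G \<and> R G) \<and> A \<subseteq> \<Union>\<G>"
proof -
  have "\<exists>\<G>. finite \<G> \<and> pairwise disjnt \<G> \<and> (\<forall>G\<in>\<G>. openin Q G \<and> R G) \<and> A \<inter> \<Union>\<F> \<subseteq> \<Union>\<G>"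
    if "finite \<F>" "\<And>P. P \<in> \<F> \<Longrightarrow> openin Q P \<and> R P \<and> closedin Q (A \<inter> P)" for \<F>
    using that
  proof (induction \<F>)
    case empty
    then show ?case by (intro exI[of _ "{}"]) auto
  next
    case (insert P \<F>)
    then obtain \<G> where \<G>: "finite \<G>" "pairwise disjnt \<G>" "\<And>G. G \<in> \<G> \<Longrightarrow> openin Q G \<and> R G"
        "A \<inter> \<Union>\<F> \<subseteq> \<Union>\<G>" by auto
    have "A \<inter> \<Union>\<F> = \<Union>((\<inter>) A ` \<F>)" by auto
    then have c1: "closedin Q (A \<inter> \<Union>\<F>)"
      using insert by (metis (mono_tags, lifting) closedin_Union finite_imageI image_iff insertCI)
    have c2: "closedin Q ((A \<inter> P) - \<Union>\<F>)"
      using insert by (intro closedin_diff openin_Union) auto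
    have "disjnt (A \<inter> \<Union>\<F>) ((A \<inter> P) - \<Union>\<F>)" by (auto simp: disjnt_def)
    then obtain S T where ST: "openin Q S" "openin Q T" "A \<inter> \<Union>\<F> \<subseteq> S" "(A \<inter> P) - \<Union>\<F> \<subseteq> T" "disjnt S T"
      by (rule Hausdorff_space_compact_separation[OF Q(2) closedin_compact_space[OF Q(1) c1] closedin_compact_space[OF Q(1) c2]])
    let ?G = "insert (P \<inter> T) ((\<lambda>G. G \<inter> S) ` \<G>)"
    have "pairwise disjnt ?G"
      using ST(5) \<G>(2) by (fastforce simp: pairwise_def disjnt_iff)
    moreover have "\<forall>G\<in>?G. openin Q G \<and> R G"
      using \<G>(3) insert.prems ST mono by (auto intro: mono[OF _ Int_lower1])
    moreover have "A \<inter> \<Union>(insert P \<F>) \<subseteq> \<Union>?G"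
    proof
      fix x assume x: "x \<in> A \<inter> \<Union>(insert P \<F>)"
      show "x \<in> \<Union>?G"
      proof (cases "x \<in> \<Union>\<F>")
        case True
        then have "x \<in> A \<inter> \<Union>\<F>" using x by simp
        then have "x \<in> S" "x \<in> \<Union>\<G>" using ST(3) \<G>(4) by (meson subsetD)+
        then show ?thesis by auto
      next
        case False
        then show ?thesis using x ST(4) by auto
      qed
    qed
    ultimately show ?case using \<G>(1) by (intro exI[of _ ?G]) auto
  qed
  moreover obtain \<F> where "finite \<F>" "\<And>P. P \<in> \<F> \<Longrightarrow> openin Q P \<and> R P \<and> closedin Q (A \<inter> P)" "A \<subseteq> \<Union>\<F>"
  proof -
    have "compactin Q A" using A Q closedin_compact_space by blast
    moreover have "A \<subseteq> \<Union>{P. openin Q P \<and> R P \<and> closedin Q (A \<inter> P)}" using loc by blast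
    ultimately show thesis using that compactinD[of Q A "{P. openin Q P \<and> R P \<and> closedin Q (A \<inter> P)}"] by blast
  qed
  ultimately show ?thesis by (metis inf.absorb1)
qed

text \<open>In a compact Hausdorff space components and quasi-components agree. The cut wire fence
  theorem yields the separation because no connected subset of \<open>M\<close> meets both
  \<open>q\<close> and \<open>F\<close>.\<close>

lemma clopen_missing_component:
  assumes Q: "compact_space Q" "Hausdorff_space Q" and M: "closedin Q M" and q: "q \<in> M"
    and F: "closedin Q F" "F \<subseteq> M" "connected_component_of_set (subtopology Q M) q \<inter> F = {}"
  shows "\<exists>N. q \<in> N \<and> N \<inter> F = {} \<and> N \<subseteq> M \<and> closedin Q N \<and> closedin Q (M - N)"
proof -
  have top: "topspace (subtopology Q M) = M" using M closedin_subset by auto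
  have "separated_between (subtopology Q M) {q} F"
  proof (rule cut_wire_fence_theorem)
    show "compact_space (subtopology Q M)" using M Q closedin_compact_space compact_space_subtopology by blast
    show "Hausdorff_space (subtopology Q M)" using Q Hausdorff_space_subtopology by blast
    then show "closedin (subtopology Q M) {q}" using q top closedin_Hausdorff_singleton by metis
    show "closedin (subtopology Q M) F" using F closedin_subset_topspace by blast
    show "disjnt C {q} \<or> disjnt C F" if "connectedin (subtopology Q M) C" for C
    proof (cases "q \<in> C")
      case True
      then have "C \<subseteq> connected_component_of_set (subtopology Q M) q"
        using that connected_component_of_maximal by metis
      then show ?thesis using F(3) unfolding disjnt_def by blast
    qed auto
  qed
  then obtain U V where UV: "closedin (subtopology Q M) U" "closedin (subtopology Q M) V" "U \<union> V = M"
      "disjnt U V" "q \<in> U" "F \<subseteq> V"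
    unfolding separated_between_alt top by blast
  then have "M - U = V" unfolding disjnt_def by blast
  then show ?thesis
    using UV M closedin_trans_full unfolding disjnt_def by (intro exI[of _ U]) (auto simp: closedin_closed_subtopology)
qed

lemma connected_component_of_closed_subset:
  assumes M: "closedin Q M" and q: "q \<in> M"
  defines "C \<equiv> connected_component_of_set (subtopology Q M) q"
  shows "closedin Q C" "C \<subseteq> M" "connectedin Q C" "q \<in> C"
proof -
  have top: "topspace (subtopology Q M) = M" using M closedin_subset by auto
  have "closedin (subtopology Q M) C" unfolding C_def by (rule closedin_connected_component_of)
  then show "closedin Q C" "C \<subseteq> M" using M by (simp_all add: closedin_closed_subtopology)
  have "connectedin (subtopology Q M) C" unfolding C_def by (rule connectedin_connected_component_of)
  then show "connectedin Q C" by (simp add: connectedin_subtopology)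
  show "q \<in> C" unfolding C_def using q top connected_component_of_refl by (metis mem_Collect_eq)
qed

text \<open>If every component of \<open>M\<close> failed to lift some subcontinuum, each point of
  \<open>M\<close> would have an obstructed neighbourhood that is clopen in \<open>M\<close>.
  Finitely many disjoint ones cover \<open>M\<close>, hence also some \<open>Z\<close> carrying a
  transfer. Each piece of \<open>Z\<close> has odd degree nowhere, yet \<open>Z\<close> has odd
  degree over every point of \<open>X\<close>.\<close>

theorem weakly_confluent_component:
  assumes Q: "compact_space Q" "Hausdorff_space Q" and X: "continuum X"
    and p: "continuous_map Q X p" and M: "closedin Q M"
    and tr: "\<And>W. openin Q W \<Longrightarrow> M \<subseteq> W \<Longrightarrow> \<exists>Z \<Phi>. closedin Q Z \<and> Z \<subseteq> W \<and> transfer Q X p Z \<Phi>"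
  obtains C where "closedin Q C" "C \<subseteq> M" "connectedin Q C"
    "\<And>K. subcontinuum X K \<Longrightarrow> \<exists>L\<subseteq>C. L \<noteq> {} \<and> compactin Q L \<and> connectedin Q L \<and> p ` L = K"
proof (rule ccontr)
  note XX = X[unfolded continuum_def]
  note found = that
  assume neg: "\<not> thesis"
  have preim: "closedin Q {x \<in> topspace Q. p x \<in> K}" if "subcontinuum X K" for K
    using that XX compactin_imp_closedin unfolding subcontinuum_def
    by (intro closedin_continuous_map_preimage[OF p]) auto
  have "\<exists>P. openin Q P \<and> q \<in> P \<and> lifting_obstruction Q X p P \<and> closedin Q (M \<inter> P)" if q: "q \<in> M" for q
  proof -
    let ?C = "connected_component_of_set (subtopology Q M) q"
    note C = connected_component_of_closed_subset[OF M q]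
    obtain K where K: "subcontinuum X K"
        "\<And>L. L \<subseteq> ?C \<Longrightarrow> L \<noteq> {} \<Longrightarrow> compactin Q L \<Longrightarrow> connectedin Q L \<Longrightarrow> p ` L \<noteq> K"
      using neg found[OF C(1-3)] by blast
    let ?A = "?C \<inter> {x \<in> topspace Q. p x \<in> K}"
    have A: "closedin Q ?A" using C preim[OF K(1)] by blast
    have "\<exists>\<G>. finite \<G> \<and> pairwise disjnt \<G> \<and> (\<forall>G\<in>\<G>. openin Q G \<and> \<not> K \<subseteq> p ` G) \<and> ?A \<subseteq> \<Union>\<G>"
    proof (rule finite_disjoint_open_cover[OF Q A])
      fix a assume a: "a \<in> ?A"
      let ?L = "connected_component_of_set (subtopology Q ?A) a"
      note L = connected_component_of_closed_subset[OF A a]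
      have "p ` ?L \<noteq> K"
        by (rule K(2)) (use L closedin_compact_space[OF Q(1)] in auto)
      then obtain x where x: "x \<in> K" "x \<notin> p ` ?L" using L(2) by blast
      have xX: "x \<in> topspace X" using x K(1) unfolding subcontinuum_def by blast
      have clx: "closedin Q {y \<in> topspace Q. p y \<in> {x}}"
        using XX xX by (intro closedin_continuous_map_preimage[OF p]) (simp add: closedin_Hausdorff_singleton)
      have "?L \<inter> (?A \<inter> {y \<in> topspace Q. p y \<in> {x}}) = {}" using x(2) by auto
      from clopen_missing_component[OF Q A a closedin_Int[OF A clx] Int_lower1 this]
      obtain N where N: "a \<in> N" "N \<inter> (?A \<inter> {y \<in> topspace Q. p y \<in> {x}}) = {}" "N \<subseteq> ?A"
          "closedin Q N" "closedin Q (?A - N)"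
        by (elim exE conjE)
      \<comment> \<open>Removing \<open>?A - N\<close> makes \<open>?P\<close> meet
        \<open>?A\<close> exactly in the clopen piece \<open>N\<close>. Removing the fibre over
        \<open>x\<close>, which \<open>N\<close> avoids, keeps the image of \<open>?P\<close> from
        covering \<open>K\<close>.\<close>
      let ?P = "topspace Q - ((?A - N) \<union> {y \<in> topspace Q. p y \<in> {x}})"
      have "openin Q ?P" using N(5) clx by blast
      moreover have "a \<in> ?P" using N a by auto
      moreover have "\<not> K \<subseteq> p ` ?P" using x by auto
      moreover have "?A \<inter> ?P = N" using N(2,3) a by auto
      then have "closedin Q (?A \<inter> ?P)" using N(4) by (rule ssubst)
      ultimately show "\<exists>P. openin Q P \<and> a \<in> P \<and> \<not> K \<subseteq> p ` P \<and> closedin Q (?A \<inter> P)"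
        by (intro exI[of _ ?P] conjI)
    qed blast
    then obtain \<G> where \<G>: "finite \<G>" "pairwise disjnt \<G>" "\<And>G. G \<in> \<G> \<Longrightarrow> openin Q G \<and> \<not> K \<subseteq> p ` G" "?A \<subseteq> \<Union>\<G>"
      by blast
    \<comment> \<open>The obstruction found on the component \<open>?C\<close> is thickened to an
      open set: all points over \<open>K\<close> outside the chosen open sets are discarded, and
      \<open>?C\<close> contains none of them.\<close>
    let ?P0 = "topspace Q - ({x \<in> topspace Q. p x \<in> K} - \<Union>\<G>)"
    have P0: "openin Q ?P0" using preim[OF K(1)] \<G>(3) by (intro openin_diff closedin_diff openin_Union) auto
    have obs: "lifting_obstruction Q X p ?P0"
      unfolding lifting_obstruction_def using K(1) \<G> by (intro exI[of _ K] exI[of _ \<G>]) auto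
    have "?C \<inter> (M - ?P0) = {}" using \<G>(4) M closedin_subset C by blast
    from clopen_missing_component[OF Q M q closedin_diff[OF M P0] Diff_subset this]
    obtain N where N: "q \<in> N" "N \<inter> (M - ?P0) = {}" "N \<subseteq> M" "closedin Q N" "closedin Q (M - N)"
      by (elim exE conjE)
    let ?P = "?P0 - (M - N)"
    have "openin Q ?P" by (rule openin_diff[OF P0 N(5)])
    moreover have "M \<inter> ?P = N" using N(2,3) by auto
    then have "closedin Q (M \<inter> ?P)" using N(4) by (rule ssubst)
    moreover have "q \<in> ?P" using N(1,2,3) by auto
    moreover have "lifting_obstruction Q X p ?P" by (rule lifting_obstruction_mono[OF obs]) auto
    ultimately show ?thesis by (intro exI[of _ ?P] conjI)
  qed
  from finite_disjoint_open_cover[of Q M "lifting_obstruction Q X p", OF Q M _ this]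
    lifting_obstruction_mono[of Q X p]
  have "\<exists>\<P>. finite \<P> \<and> pairwise disjnt \<P> \<and> (\<forall>P\<in>\<P>. openin Q P \<and> lifting_obstruction Q X p P) \<and> M \<subseteq> \<Union>\<P>"
    by simp
  then
  obtain \<P> where \<P>0: "finite \<P>" "pairwise disjnt \<P>"
      "\<forall>P\<in>\<P>. openin Q P \<and> lifting_obstruction Q X p P" "M \<subseteq> \<Union>\<P>"
    by (elim exE conjE)
  note \<P> = \<P>0(1,2) bspec[OF \<P>0(3)] \<P>0(4)
  \<comment> \<open>The disjoint open sets cut \<open>Z\<close> into clopen pieces, and an
    obstruction is inherited by subsets.\<close>
  obtain Z \<Phi> where Z: "closedin Q Z" "Z \<subseteq> \<Union>\<P>" "transfer Q X p Z \<Phi>"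
    using tr[of "\<Union>\<P>"] \<P> by (metis openin_Union)
  have "\<Phi> (Z \<inter> P) = {}" if P: "P \<in> \<P>" for P
  proof (rule transfer_obstructed[OF Z(3) _ _ p Z(1)])
    have "Z \<inter> P = Z - \<Union>(\<P> - {P})"
      using disjoint_family_Int_eq_Diff[OF \<P>(2) P Z(2)] by simp
    then show "closedin Q (Z \<inter> P)" using Z(1) \<P>(3) by (metis DiffD1 closedin_diff openin_Union)
    show "closedin Q (Z - Z \<inter> P)" using Z(1) \<P>(3)[OF P] by (simp add: Diff_Int closedin_diff)
    show "lifting_obstruction Q X p (Z \<inter> P)" using \<P>(3)[OF P] lifting_obstruction_mono by blast
  qed (use XX in auto)
  then have "\<Phi> (Z \<inter> \<Union>\<P>) = {}" using transfer_Union_empty[OF Z(3) \<P>(1,2)] by blast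
  then have "\<Phi> Z = {}" using Z(2) by (simp add: inf.absorb1)
  then show False using transfer.total[OF Z(3)] XX by auto
qed

section \<open>Transfers along one coordinate\<close>

text \<open>Additivity on disjoint sets makes \<open>\<Phi>\<close> a homomorphism for symmetric
  difference, the addition modulo 2. The common part of \<open>A\<close> and \<open>B\<close>
  contributes twice and cancels.\<close>

lemma transfer_sym_diff:
  assumes "transfer Q X p Z \<Phi>"
  shows "\<Phi> ((A - B) \<union> (B - A)) = (\<Phi> A - \<Phi> B) \<union> (\<Phi> B - \<Phi> A)"
proof -
  have 1: "\<Phi> ((A - B) \<union> (B - A)) = (\<Phi> (A - B) - \<Phi> (B - A)) \<union> (\<Phi> (B - A) - \<Phi> (A - B))"
    by (rule transfer.Un[OF assms]) auto
  have 2: "\<Phi> ((A - B) \<union> (A \<inter> B)) = (\<Phi> (A - B) - \<Phi> (A \<inter> B)) \<union> (\<Phi> (A \<inter> B) - \<Phi> (A - B))"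
    by (rule transfer.Un[OF assms]) auto
  have 3: "\<Phi> ((B - A) \<union> (A \<inter> B)) = (\<Phi> (B - A) - \<Phi> (A \<inter> B)) \<union> (\<Phi> (A \<inter> B) - \<Phi> (B - A))"
    by (rule transfer.Un[OF assms]) auto
  have "(A - B) \<union> (A \<inter> B) = A" "(B - A) \<union> (A \<inter> B) = B" by auto
  with 1 2 3 show ?thesis by auto
qed

text \<open>Here \<open>\<Psi>\<close> counts the sheets of one coordinate and respects the fibres
  of \<open>p\<close>. For complementary closed \<open>A\<close> and \<open>B\<close> over
  \<open>K\<close>, the sets \<open>\<Psi> A\<close> and \<open>\<Psi> B\<close> lie in
  \<open>Z0\<close> over \<open>K\<close> and have that whole set as symmetric difference. They are
  thus complementary again, and closedness for \<open>\<Phi>\<close> applies.\<close>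

lemma transfer_comp:
  assumes T: "transfer Q X p Z0 \<Phi>"
    and Un: "\<And>A B. A \<inter> B = {} \<Longrightarrow> \<Psi> (A \<union> B) = (\<Psi> A - \<Psi> B) \<union> (\<Psi> B - \<Psi> A)"
    and img: "\<And>A. p ` \<Psi> A \<subseteq> p ` A"
    and tot: "\<Psi> Z = Z0"
    and sub: "\<And>A. A \<subseteq> Z \<Longrightarrow> \<Psi> A \<subseteq> Z0"
    and clo: "\<And>K A B. \<lbrakk>closedin X K; closedin Q A; closedin Q B; A \<inter> B = {}; A \<union> B = Z \<inter> p -` K\<rbrakk>
      \<Longrightarrow> closedin Q (\<Psi> A)"
  shows "transfer Q X p Z (\<Phi> \<circ> \<Psi>)"
proof
  show "(\<Phi> \<circ> \<Psi>) (A \<union> B) = ((\<Phi> \<circ> \<Psi>) A - (\<Phi> \<circ> \<Psi>) B) \<union> ((\<Phi> \<circ> \<Psi>) B - (\<Phi> \<circ> \<Psi>) A)" if "A \<inter> B = {}" for A B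
    using Un[OF that] transfer_sym_diff[OF T] by simp
  show "(\<Phi> \<circ> \<Psi>) A \<subseteq> p ` A" for A
    using transfer.image[OF T, of "\<Psi> A"] img[of A] by simp
  show "topspace X \<subseteq> (\<Phi> \<circ> \<Psi>) Z" using tot transfer.total[OF T] by simp
  fix K A B assume *: "closedin X K" "closedin Q A" "closedin Q B" "A \<inter> B = {}" "A \<union> B = Z \<inter> p -` K"
  have cl: "closedin Q (\<Psi> A)" using clo[OF *] .
  have cl': "closedin Q (\<Psi> B)" by (rule clo[of K B A]) (use * in auto)
  have "\<Psi> ((Z \<inter> p -` K) \<union> (Z - p -` K)) = (\<Psi> (Z \<inter> p -` K) - \<Psi> (Z - p -` K)) \<union> (\<Psi> (Z - p -` K) - \<Psi> (Z \<inter> p -` K))"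
    by (rule Un) auto
  then have Z0: "Z0 = (\<Psi> (Z \<inter> p -` K) - \<Psi> (Z - p -` K)) \<union> (\<Psi> (Z - p -` K) - \<Psi> (Z \<inter> p -` K))"
    using tot by (simp add: Int_Diff_Un)
  have "\<Psi> (Z - p -` K) \<inter> p -` K = {}" "\<Psi> (Z \<inter> p -` K) \<subseteq> p -` K"
    using img[of "Z - p -` K"] img[of "Z \<inter> p -` K"] by auto
  then have "\<Psi> (Z \<inter> p -` K) = Z0 \<inter> p -` K" using Z0 by auto
  then have eq: "(\<Psi> A - \<Psi> B) \<union> (\<Psi> B - \<Psi> A) = Z0 \<inter> p -` K" using Un[OF *(4)] *(5) by simp
  have "A \<subseteq> Z" "B \<subseteq> Z" "p ` A \<subseteq> K" "p ` B \<subseteq> K" using *(5) by auto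
  then have "\<Psi> A \<subseteq> Z0 \<inter> p -` K" "\<Psi> B \<subseteq> Z0 \<inter> p -` K"
    using sub[of A] sub[of B] img[of A] img[of B] by (auto simp: image_subset_iff)
  with eq have "\<Psi> A \<inter> \<Psi> B = {}" "\<Psi> A \<union> \<Psi> B = Z0 \<inter> p -` K" by blast+
  then show "closedin X ((\<Phi> \<circ> \<Psi>) A)"
    using transfer.closed[OF T *(1) cl cl'] by simp
qed

section \<open>Complete graphs in the Hilbert cube and the two kinds of equations\<close>

definition vertex :: "nat \<Rightarrow> nat \<Rightarrow> real" where
  "vertex i = (\<lambda>k. if k = i then 1 else 0)"

definition edge :: "nat \<Rightarrow> nat \<Rightarrow> (nat \<Rightarrow> real) set" where
  "edge i k = (\<lambda>s l. s * vertex i l + (1 - s) * vertex k l) ` {0..1}"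

text \<open>With countably many entries, one compact factor accommodates the complete graph on any
  finite vertex set.\<close>

definition cube :: "(nat \<Rightarrow> real) set" where
  "cube = {t. \<forall>l. 0 \<le> t l \<and> t l \<le> 1}"

lemma vertex_eq_iff [simp]: "vertex i = vertex k \<longleftrightarrow> i = k"
  unfolding vertex_def fun_eq_iff by (metis zero_neq_one)

lemma continuous_on_edge: "continuous_on S (\<lambda>s l. s * vertex i l + (1 - s) * vertex k l)"
  by (intro continuous_on_coordinatewise_then_product continuous_intros)

lemma connected_edge: "connected (edge i k)"
  unfolding edge_def by (intro connected_continuous_image continuous_on_edge) auto

lemma closed_edge: "closed (edge i k)"
  unfolding edge_def by (intro compact_imp_closed compact_continuous_image continuous_on_edge) auto

lemma vertex_in_edge [simp]: "vertex i \<in> edge i k" "vertex k \<in> edge i k"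
  unfolding edge_def by (auto intro: image_eqI[of _ _ 1] image_eqI[of _ _ 0])

lemma edge_refl [simp]: "edge i i = {vertex i}"
  unfolding edge_def by (auto simp: algebra_simps fun_eq_iff intro: image_eqI[of _ _ 1])

lemma edge_subset_cube: "edge i k \<subseteq> cube"
proof -
  have "s * (if l = i then 1 else 0) + (1 - s) * (if l = k then 1 else 0) \<in> {0..1}" if "s \<in> {0..1}" for s :: real and l
    using that by auto
  then show ?thesis unfolding edge_def cube_def vertex_def by auto
qed

lemma vertex_in_cube [simp]: "vertex i \<in> cube"
  using edge_subset_cube vertex_in_edge by blast

lemma edge_coordinates:
  assumes "t \<in> edge i k"
  shows "l \<noteq> i \<Longrightarrow> l \<noteq> k \<Longrightarrow> t l = 0" "i \<noteq> k \<Longrightarrow> t i + t k = 1" "0 \<le> t l" "\<exists>l\<in>{i,k}. 0 < t l"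
  using assms unfolding edge_def vertex_def by (auto simp: not_less)

lemma vertex_in_edge_iff: "vertex l \<in> edge i k \<longleftrightarrow> l = i \<or> l = k"
proof
  show "l = i \<or> l = k" if "vertex l \<in> edge i k"
    using edge_coordinates(1)[OF that, of l] by (auto simp: vertex_def)
qed auto

lemma compact_cube: "compact cube"
proof -
  have "compactin (product_topology (\<lambda>_. euclidean) UNIV) (Pi\<^sub>E UNIV (\<lambda>_::nat. {0..1::real}))"
    by (simp add: compactin_PiE)
  moreover have "Pi\<^sub>E UNIV (\<lambda>_::nat. {0..1::real}) = cube" unfolding cube_def by (auto simp: PiE_iff)
  ultimately show ?thesis by (simp add: euclidean_product_topology)
qed

text \<open>When \<open>U\<close> and \<open>V\<close> have disjoint closures, there are three
  sheets off both sets, only sheet 0 over \<open>U\<close> and only sheet 2 over \<open>V\<close>.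
  Sheets 1 and 2 meet at the frontier of \<open>U\<close>, sheets 0 and 1 at that of
  \<open>V\<close>.\<close>

definition zigzag :: "'q topology \<Rightarrow> 'q set \<Rightarrow> 'q set \<Rightarrow> 'q \<Rightarrow> (nat \<Rightarrow> real) \<Rightarrow> bool" where
  "zigzag Q U V q t \<longleftrightarrow> q \<notin> V \<and> t = vertex 0 \<or> q \<in> Q closure_of V - V \<and> t \<in> edge 0 1 \<or>
     q \<notin> U \<and> q \<notin> V \<and> t = vertex 1 \<or> q \<in> Q closure_of U - U \<and> t \<in> edge 1 2 \<or> q \<notin> U \<and> t = vertex 2"

text \<open>The case \<open>i = k\<close> gives the degenerate edge, so a point in a single member
  of the cover has a single vertex above it.\<close>

definition cover_graph :: "(nat \<Rightarrow> 'q set) \<Rightarrow> nat \<Rightarrow> 'q \<Rightarrow> (nat \<Rightarrow> real) \<Rightarrow> bool" where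
  "cover_graph F m q t \<longleftrightarrow> (\<exists>i<m. \<exists>k<m. q \<in> F i \<and> q \<in> F k \<and> t \<in> edge i k)"

section \<open>Varying a single coordinate\<close>

text \<open>An abstract product decomposition with one cube factor: \<open>c\<close> reads that
  factor and \<open>upd\<close> overwrites it. Continuity in \<open>q\<close> makes slices of closed
  sets closed; continuity in \<open>t\<close> sends edges to connected sets.\<close>

locale coordinate =
  fixes Q :: "'q topology" and X :: "'a topology" and p :: "'q \<Rightarrow> 'a"
    and c :: "'q \<Rightarrow> nat \<Rightarrow> real" and upd :: "'q \<Rightarrow> (nat \<Rightarrow> real) \<Rightarrow> 'q"
  assumes c: "continuous_map Q (top_of_set cube) c"
    and upd1: "\<And>t. t \<in> cube \<Longrightarrow> continuous_map Q Q (\<lambda>q. upd q t)"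
    and upd2: "\<And>q. q \<in> topspace Q \<Longrightarrow> continuous_map (top_of_set cube) Q (upd q)"
    and c_upd: "\<And>q t. q \<in> topspace Q \<Longrightarrow> t \<in> cube \<Longrightarrow> c (upd q t) = t"
    and upd_c: "\<And>q. q \<in> topspace Q \<Longrightarrow> upd q (c q) = q"
    and upd_upd: "\<And>q t s. q \<in> topspace Q \<Longrightarrow> t \<in> cube \<Longrightarrow> s \<in> cube \<Longrightarrow> upd (upd q t) s = upd q s"
    and p_upd: "\<And>q t. q \<in> topspace Q \<Longrightarrow> t \<in> cube \<Longrightarrow> p (upd q t) = p q"
begin

definition invariant :: "'q set \<Rightarrow> bool" where
  "invariant S \<longleftrightarrow> (\<forall>q\<in>topspace Q. \<forall>t\<in>cube. upd q t \<in> S \<longleftrightarrow> q \<in> S)"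

lemma upd_in: "q \<in> topspace Q \<Longrightarrow> t \<in> cube \<Longrightarrow> upd q t \<in> topspace Q"
  using upd1 continuous_map_image_subset_topspace by fastforce

lemma c_in: "q \<in> topspace Q \<Longrightarrow> c q \<in> cube"
  using c continuous_map_image_subset_topspace by fastforce

text \<open>Overwriting is continuous, so it carries closures into closures; the converse follows by
  restoring the old value \<open>c q\<close>. Thus closures and frontiers of invariant sets may
  enter the equations.\<close>

lemma invariant_closure:
  assumes "invariant S"
  shows "invariant (Q closure_of S)"
proof -
  have step: "upd q t \<in> Q closure_of S" if q: "q \<in> Q closure_of S" and t: "t \<in> cube" for q t
  proof -
    have "q \<in> Q closure_of (S \<inter> topspace Q)" using q by (subst (asm) closure_of_restrict) (simp add: inf_commute)
    then have "upd q t \<in> Q closure_of ((\<lambda>q. upd q t) ` (S \<inter> topspace Q))"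
      using continuous_map_image_closure_subset[OF upd1[OF t]] by blast
    moreover have "(\<lambda>q. upd q t) ` (S \<inter> topspace Q) \<subseteq> S" using assms t unfolding invariant_def by auto
    ultimately show ?thesis using closure_of_mono by blast
  qed
  show ?thesis
    unfolding invariant_def
  proof (intro ballI iffI)
    fix q t assume q: "q \<in> topspace Q" and t: "t \<in> cube" and "upd q t \<in> Q closure_of S"
    then have "upd (upd q t) (c q) \<in> Q closure_of S" using step c_in[OF q] by blast
    then show "q \<in> Q closure_of S" using upd_upd[OF q t c_in[OF q]] upd_c[OF q] by simp
  qed (use step in auto)
qed

lemma invariant_iff: "invariant S \<Longrightarrow> q \<in> topspace Q \<Longrightarrow> t \<in> cube \<Longrightarrow> upd q t \<in> S \<longleftrightarrow> q \<in> S"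
  unfolding invariant_def by blast

lemma closedin_slice:
  "closedin Q A \<Longrightarrow> closedin Q {q \<in> topspace Q. upd q (vertex i) \<in> A}"
  by (rule closedin_continuous_map_preimage[OF upd1]) simp_all

text \<open>The image of an edge in one fibre is connected, so it cannot be divided between the
  disjoint closed sets \<open>A\<close> and \<open>B\<close>.\<close>

lemma slices_along_edge:
  assumes A: "closedin Q A" "closedin Q B" "A \<inter> B = {}" and q: "q \<in> topspace Q"
    and e: "\<And>t. t \<in> edge i k \<Longrightarrow> upd q t \<in> A \<union> B"
  shows "upd q (vertex i) \<in> A \<longleftrightarrow> upd q (vertex k) \<in> A"
proof -
  have "connectedin (top_of_set cube) (edge i k)"
    using edge_subset_cube connected_edge by (simp add: connectedin_subtopology)
  then have "connectedin Q (upd q ` edge i k)"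
    using connectedin_continuous_map_image[OF upd2[OF q]] by blast
  moreover have "upd q ` edge i k \<subseteq> A \<union> B" using e by auto
  ultimately have "A \<inter> upd q ` edge i k = {} \<or> B \<inter> upd q ` edge i k = {}"
    using A unfolding connectedin_closedin by (metis Int_assoc Int_empty_left)
  moreover have "upd q (vertex i) \<in> upd q ` edge i k" "upd q (vertex k) \<in> upd q ` edge i k" by auto
  ultimately show ?thesis using \<open>upd q ` edge i k \<subseteq> A \<union> B\<close> A(3) by blast
qed

lemma closedin_coordinate_edge: "closedin Q {q \<in> topspace Q. c q \<in> edge i k}"
proof (rule closedin_continuous_map_preimage[OF c])
  show "closedin (top_of_set cube) (edge i k)"
    using closed_edge edge_subset_cube by (simp add: closed_subset)
qed

lemma closedin_cover_graph:
  assumes "\<And>i. i < m \<Longrightarrow> closedin Q (F i)"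
  shows "closedin Q {q \<in> topspace Q. cover_graph F m q (c q)}"
proof -
  have "{q \<in> topspace Q. cover_graph F m q (c q)} =
      (\<Union>i\<in>{..<m}. \<Union>k\<in>{..<m}. F i \<inter> F k \<inter> {q \<in> topspace Q. c q \<in> edge i k})"
    unfolding cover_graph_def using closedin_subset[OF assms] by auto
  then show ?thesis
    using assms closedin_coordinate_edge by (auto intro!: closedin_Union closedin_Int)
qed

lemma closedin_zigzag:
  assumes "openin Q U" "openin Q V"
  shows "closedin Q {q \<in> topspace Q. zigzag Q U V q (c q)}"
proof -
  let ?E = "\<lambda>i k. {q \<in> topspace Q. c q \<in> edge i k}"
  \<comment> \<open>Single vertices are written as degenerate edges, so that closedness of edge
    conditions covers all five clauses.\<close>
  have "{q \<in> topspace Q. zigzag Q U V q (c q)} =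
      ((topspace Q - V) \<inter> ?E 0 0) \<union> ((Q closure_of V - V) \<inter> ?E 0 1) \<union>
      (((topspace Q - U) \<inter> (topspace Q - V)) \<inter> ?E 1 1) \<union> ((Q closure_of U - U) \<inter> ?E 1 2) \<union>
      ((topspace Q - U) \<inter> ?E 2 2)"
    unfolding zigzag_def by auto
  moreover have "closedin Q (topspace Q - U)" "closedin Q (topspace Q - V)"
      "closedin Q (Q closure_of V - V)" "closedin Q (Q closure_of U - U)"
    using assms by auto
  ultimately show ?thesis by (simp only: closedin_Int closedin_Un closedin_coordinate_edge)
qed

text \<open>Fibres over \<open>Z0\<close> are connected, so one vertex represents a whole fibre.
  Choosing the vertex of least index is not continuous, but for a clopen \<open>A\<close> the choice
  is immaterial: vertices in a fibre are joined by edges. Hence \<open>\<Psi> A\<close> is a finite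
  union of closed slices.\<close>

lemma cover_graph_transfer:
  assumes T: "transfer Q X p Z0 \<Phi>" and Z0: "invariant Z0" "Z0 \<subseteq> topspace Q"
    and F: "\<And>i. i < m \<Longrightarrow> closedin Q (F i)" "\<And>i. i < m \<Longrightarrow> invariant (F i)" "topspace Q \<subseteq> (\<Union>i<m. F i)"
  shows "\<exists>\<Phi>'. transfer Q X p (Z0 \<inter> {q \<in> topspace Q. cover_graph F m q (c q)}) \<Phi>'"
proof -
  let ?Z = "Z0 \<inter> {q \<in> topspace Q. cover_graph F m q (c q)}"
  define l where "l q = (LEAST i. i < m \<and> q \<in> F i)" for q
  define \<Psi> where "\<Psi> N = {q \<in> topspace Q. upd q (vertex (l q)) \<in> N}" for N
  have l: "l q < m" "q \<in> F (l q)" if "q \<in> topspace Q" for q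
  proof -
    have "\<exists>i. i < m \<and> q \<in> F i" using F(3) that by auto
    then show "l q < m" "q \<in> F (l q)" unfolding l_def by (metis (mono_tags, lifting) LeastI_ex)+
  qed
  have mem: "upd q t \<in> ?Z \<longleftrightarrow> q \<in> Z0 \<and> cover_graph F m q t" if "q \<in> topspace Q" "t \<in> cube" for q t
  proof -
    have "upd q t \<in> F i \<longleftrightarrow> q \<in> F i" if "i < m" for i
      using invariant_iff[OF F(2)[OF that]] \<open>q \<in> topspace Q\<close> \<open>t \<in> cube\<close> .
    then have "cover_graph F m (upd q t) t \<longleftrightarrow> cover_graph F m q t" unfolding cover_graph_def by blast
    then show ?thesis using upd_in[OF that] c_upd[OF that] invariant_iff[OF Z0(1) that] by simp
  qed
  have tot: "\<Psi> ?Z = Z0"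
  proof (intro set_eqI)
    fix q
    have "cover_graph F m q (vertex (l q))" if "q \<in> topspace Q"
      unfolding cover_graph_def using l[OF that] vertex_in_edge(1) by blast
    then show "q \<in> \<Psi> ?Z \<longleftrightarrow> q \<in> Z0"
      unfolding \<Psi>_def using mem[of q "vertex (l q)"] Z0(2) by auto
  qed
  have "transfer Q X p ?Z (\<Phi> \<circ> \<Psi>)"
  proof (rule transfer_comp[where \<Psi> = \<Psi>, OF T _ _ tot])
    show "\<Psi> (A \<union> B) = (\<Psi> A - \<Psi> B) \<union> (\<Psi> B - \<Psi> A)" if "A \<inter> B = {}" for A B
      using that unfolding \<Psi>_def by auto
    show "p ` \<Psi> A \<subseteq> p ` A" for A
    proof
      fix x assume "x \<in> p ` \<Psi> A"
      then obtain q i where "q \<in> topspace Q" "upd q (vertex i) \<in> A" "x = p q" unfolding \<Psi>_def by auto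
      then show "x \<in> p ` A" using p_upd[of q "vertex i"] by (metis imageI vertex_in_cube)
    qed
    show "\<Psi> A \<subseteq> Z0" if "A \<subseteq> ?Z" for A
      using that tot unfolding \<Psi>_def by blast
    fix K A B assume AB: "closedin X K" "closedin Q A" "closedin Q B" "A \<inter> B = {}" "A \<union> B = ?Z \<inter> p -` K"
    have memAB: "upd q t \<in> A \<union> B \<longleftrightarrow> q \<in> Z0 \<and> p q \<in> K \<and> cover_graph F m q t"
      if "q \<in> topspace Q" "t \<in> cube" for q t
      using mem[OF that] p_upd[OF that] unfolding AB(5) by auto
    have "\<Psi> A = (\<Union>i\<in>{..<m}. F i \<inter> {q \<in> topspace Q. upd q (vertex i) \<in> A})"
    proof (intro set_eqI iffI)
      show "q \<in> (\<Union>i\<in>{..<m}. F i \<inter> {q \<in> topspace Q. upd q (vertex i) \<in> A})" if "q \<in> \<Psi> A" for q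
        using that l unfolding \<Psi>_def by blast
      fix q assume "q \<in> (\<Union>i\<in>{..<m}. F i \<inter> {q \<in> topspace Q. upd q (vertex i) \<in> A})"
      then obtain i where i: "i < m" "q \<in> F i" "q \<in> topspace Q" "upd q (vertex i) \<in> A" by auto
      then have "q \<in> Z0" "p q \<in> K" using memAB[of q "vertex i"] by auto
      have "upd q t \<in> A \<union> B" if "t \<in> edge i (l q)" for t
      proof -
        have "cover_graph F m q t" unfolding cover_graph_def using that i l by blast
        then show ?thesis using memAB[of q t] that edge_subset_cube \<open>q \<in> Z0\<close> \<open>p q \<in> K\<close> i(3) by blast
      qed
      then show "q \<in> \<Psi> A"
        using slices_along_edge[OF AB(2,3,4) i(3), of i "l q"] i unfolding \<Psi>_def by blast
    qed
    then show "closedin Q (\<Psi> A)"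
      using F(1) closedin_slice[OF AB(2)] by (auto intro!: closedin_Union closedin_Int)
  qed
  then show ?thesis by blast
qed

text \<open>Counting the three vertex slices modulo 2 gives total degree one, since 3 or 1 sheets
  are present everywhere. Closedness of \<open>\<Psi> A\<close> is checked on three closed sets
  covering the space: the closures of \<open>U\<close> and \<open>V\<close> and the complement of
  their union.\<close>

lemma zigzag_transfer:
  assumes T: "transfer Q X p Z0 \<Phi>" and Z0: "invariant Z0" "Z0 \<subseteq> topspace Q"
    and UV: "openin Q U" "openin Q V" "invariant U" "invariant V" "Q closure_of U \<inter> Q closure_of V = {}"
  shows "\<exists>\<Phi>'. transfer Q X p (Z0 \<inter> {q \<in> topspace Q. zigzag Q U V q (c q)}) \<Phi>'"
proof -
  let ?Z = "Z0 \<inter> {q \<in> topspace Q. zigzag Q U V q (c q)}"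
  define s where "s N i = {q \<in> topspace Q. upd q (vertex i) \<in> N}" for N i
  \<comment> \<open>Inequality of truth values is exclusive or, so the condition says that an odd
    number of the three slices contain \<open>q\<close>.\<close>
  define \<Psi> where "\<Psi> N = {q \<in> topspace Q. (q \<in> s N 0) \<noteq> ((q \<in> s N 1) \<noteq> (q \<in> s N 2))}" for N
  note icl = invariant_closure[OF UV(3)] invariant_closure[OF UV(4)]
  have sub: "U \<subseteq> Q closure_of U" "V \<subseteq> Q closure_of V"
    using UV closure_of_subset openin_subset by metis+
  have mem: "upd q t \<in> ?Z \<longleftrightarrow> q \<in> Z0 \<and> zigzag Q U V q t" if "q \<in> topspace Q" "t \<in> cube" for q t
    using upd_in[OF that] c_upd[OF that] invariant_iff[OF Z0(1) that] invariant_iff[OF UV(3) that] invariant_iff[OF UV(4) that]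
      invariant_iff[OF icl(1) that] invariant_iff[OF icl(2) that] unfolding zigzag_def by simp
  have z: "zigzag Q U V q (vertex 0) \<longleftrightarrow> q \<notin> V"
      "zigzag Q U V q (vertex 1) \<longleftrightarrow> q \<notin> U \<and> q \<notin> V"
      "zigzag Q U V q (vertex 2) \<longleftrightarrow> q \<notin> U" for q
    using UV(5) sub unfolding zigzag_def vertex_in_edge_iff by auto
  have tot: "\<Psi> ?Z = Z0"
  proof (intro set_eqI)
    fix q
    have "q \<notin> U \<or> q \<notin> V" using UV(5) sub by blast
    moreover have "q \<in> s ?Z i \<longleftrightarrow> q \<in> Z0 \<and> zigzag Q U V q (vertex i)" for i
      using mem[of q "vertex i"] Z0(2) unfolding s_def by auto
    ultimately show "q \<in> \<Psi> ?Z \<longleftrightarrow> q \<in> Z0"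
      using Z0(2) unfolding \<Psi>_def by (auto simp: z simp del: One_nat_def)
  qed
  have "transfer Q X p ?Z (\<Phi> \<circ> \<Psi>)"
  proof (rule transfer_comp[where \<Psi> = \<Psi>, OF T _ _ tot])
    show "\<Psi> (A \<union> B) = (\<Psi> A - \<Psi> B) \<union> (\<Psi> B - \<Psi> A)" if "A \<inter> B = {}" for A B
      using that unfolding \<Psi>_def s_def by auto
    show "p ` \<Psi> A \<subseteq> p ` A" for A
    proof
      fix x assume "x \<in> p ` \<Psi> A"
      then obtain q i where "q \<in> topspace Q" "upd q (vertex i) \<in> A" "x = p q"
        unfolding \<Psi>_def s_def by auto
      then show "x \<in> p ` A" using p_upd[of q "vertex i"] by (metis imageI vertex_in_cube)
    qed
    show "\<Psi> A \<subseteq> Z0" if "A \<subseteq> ?Z" for A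
    proof
      fix q assume "q \<in> \<Psi> A"
      then obtain i where "q \<in> topspace Q" "upd q (vertex i) \<in> A"
        unfolding \<Psi>_def s_def by auto
      then show "q \<in> Z0" using that mem[of q "vertex i"] by auto
    qed
    fix K A B assume AB: "closedin X K" "closedin Q A" "closedin Q B" "A \<inter> B = {}" "A \<union> B = ?Z \<inter> p -` K"
    have memAB: "upd q t \<in> A \<union> B \<longleftrightarrow> q \<in> Z0 \<and> p q \<in> K \<and> zigzag Q U V q t"
      if "q \<in> topspace Q" "t \<in> cube" for q t
      using mem[OF that] p_upd[OF that] unfolding AB(5) by auto
    have along: "q \<in> s A i \<longleftrightarrow> q \<in> s A k"
      if q: "q \<in> topspace Q" and e: "\<And>t. t \<in> edge i k \<Longrightarrow> zigzag Q U V q t" for q i k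
    proof (cases "q \<in> Z0 \<and> p q \<in> K")
      case True
      then show ?thesis
        using slices_along_edge[OF AB(2,3,4) q, of i k] memAB[OF q] e edge_subset_cube q unfolding s_def by blast
    next
      case False
      then show ?thesis using memAB[OF q, of "vertex i"] memAB[OF q, of "vertex k"] unfolding s_def by auto
    qed
    have sAB: "q \<in> s A i \<longleftrightarrow> q \<notin> s B i" if "q \<in> topspace Q" "q \<in> Z0" "p q \<in> K" "zigzag Q U V q (vertex i)" for q i
      using memAB[of q "vertex i"] that AB(4) unfolding s_def by auto
    have sA: "q \<in> topspace Q \<and> q \<in> Z0 \<and> p q \<in> K \<and> zigzag Q U V q (vertex i)" if "q \<in> s A i \<or> q \<in> s B i" for q i
      using memAB[of q "vertex i"] that unfolding s_def by auto
    let ?W = "topspace Q - (U \<union> V)"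
    \<comment> \<open>Absence from a slice of \<open>A\<close> is expressed as presence in the slice
      of \<open>B\<close>, which keeps every term closed. Over \<open>?W\<close> all three sheets
      exist, so for \<open>q\<close> in \<open>Z0\<close> with \<open>p q\<close> in
      \<open>K\<close> each belongs to exactly one of \<open>A\<close> and \<open>B\<close>.\<close>
    let ?odd = "(s A 0 \<inter> s B 1 \<inter> s B 2) \<union> (s B 0 \<inter> s A 1 \<inter> s B 2) \<union> (s B 0 \<inter> s B 1 \<inter> s A 2) \<union> (s A 0 \<inter> s A 1 \<inter> s A 2)"
    text \<open>Over the frontier of \<open>U\<close> the sheets 1 and 2 are joined by an edge and cancel modulo 2; over the
      frontier of \<open>V\<close> the sheets 0 and 1 do.\<close>
    have "\<Psi> A = (s A 0 \<inter> Q closure_of U) \<union> (s A 2 \<inter> Q closure_of V) \<union> (?W \<inter> ?odd)"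
    proof (intro set_eqI)
      fix q
      consider "q \<notin> topspace Q" | "q \<in> topspace Q" "q \<in> Q closure_of U" | "q \<in> topspace Q" "q \<in> Q closure_of V"
        | "q \<in> ?W" "q \<notin> Q closure_of U" "q \<notin> Q closure_of V"
        using sub by blast
      then show "q \<in> \<Psi> A \<longleftrightarrow> q \<in> (s A 0 \<inter> Q closure_of U) \<union> (s A 2 \<inter> Q closure_of V) \<union> (?W \<inter> ?odd)"
      proof cases
        case 1
        then show ?thesis unfolding \<Psi>_def s_def by auto
      next
        case 2
        have nV: "q \<notin> Q closure_of V" using 2 UV(5) by blast
        have "q \<in> s A 1 \<longleftrightarrow> q \<in> s A 2"
        proof (cases "q \<in> U")
          case True
          then show ?thesis using sA[of q 1] sA[of q 2] z by blast
        next
          case False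
          then show ?thesis using 2 by (intro along) (auto simp: zigzag_def)
        qed
        moreover have "q \<in> s A i \<Longrightarrow> q \<notin> s B i" for i using AB(4) unfolding s_def by auto
        ultimately show ?thesis using 2 nV unfolding \<Psi>_def by auto
      next
        case 3
        have nU: "q \<notin> Q closure_of U" using 3 UV(5) by blast
        have "q \<in> s A 0 \<longleftrightarrow> q \<in> s A 1"
        proof (cases "q \<in> V")
          case True
          then show ?thesis using sA[of q 0] sA[of q 1] z by blast
        next
          case False
          then show ?thesis using 3 by (intro along) (auto simp: zigzag_def)
        qed
        moreover have "q \<in> s A i \<Longrightarrow> q \<notin> s B i" for i using AB(4) unfolding s_def by auto
        ultimately show ?thesis using 3 nU unfolding \<Psi>_def by auto
      next
        case 4
        then have zz: "zigzag Q U V q (vertex 0)" "zigzag Q U V q (vertex 1)" "zigzag Q U V q (vertex 2)" "q \<in> topspace Q"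
          using z by auto
        show ?thesis
        proof (cases "q \<in> Z0 \<and> p q \<in> K")
          case True
          then show ?thesis using 4 zz sAB[of q 0] sAB[of q 1] sAB[of q 2] unfolding \<Psi>_def by auto
        next
          case False
          then show ?thesis using 4 sA[of q 0] sA[of q 1] sA[of q 2] unfolding \<Psi>_def by auto
        qed
      qed
    qed
    moreover have "closedin Q (s A i)" "closedin Q (s B i)" for i
      unfolding s_def using closedin_slice AB(2,3) by blast+
    moreover have "closedin Q ?W" using UV by auto
    ultimately show "closedin Q (\<Psi> A)" by (simp only: closedin_Un closedin_Int closedin_closure_of)
  qed
  then show ?thesis by blast
qed

end

section \<open>Towers of coordinates\<close>

definition tower_space :: "'a topology \<Rightarrow> 'j set \<Rightarrow> ('a \<times> ('j \<Rightarrow> nat \<Rightarrow> real)) topology" where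
  "tower_space X J = prod_topology X (product_topology (\<lambda>_. top_of_set cube) J)"

definition set_coord :: "'j \<Rightarrow> 'a \<times> ('j \<Rightarrow> 'b) \<Rightarrow> 'b \<Rightarrow> 'a \<times> ('j \<Rightarrow> 'b)" where
  "set_coord j q t = (fst q, (snd q)(j := t))"

lemma topspace_tower_space: "topspace (tower_space X J) = topspace X \<times> (\<Pi>\<^sub>E j\<in>J. cube)"
  unfolding tower_space_def by simp

lemma compact_tower_space: "compact_space X \<Longrightarrow> compact_space (tower_space X J)"
  unfolding tower_space_def
  by (simp add: compact_space_prod_topology compact_space_product_topology compact_space_subtopology compact_cube)

lemma Hausdorff_tower_space: "Hausdorff_space X \<Longrightarrow> Hausdorff_space (tower_space X J)"
  unfolding tower_space_def
  by (simp add: Hausdorff_space_prod_topology Hausdorff_space_product_topology Hausdorff_space_subtopology)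

lemma continuous_map_coord:
  "j \<in> J \<Longrightarrow> continuous_map (tower_space X J) (top_of_set cube) (\<lambda>q. snd q j)"
  unfolding tower_space_def
  using continuous_map_compose[OF continuous_map_snd continuous_map_product_coordinates]
  by (fastforce simp: o_def)

lemma coordinate_tower_space:
  fixes X :: "'a topology" and J :: "'j set"
  assumes j: "j \<in> J"
  shows "coordinate (tower_space X J) fst (\<lambda>q. snd q j) (set_coord j)"
proof
  show "continuous_map (tower_space X J) (top_of_set cube) (\<lambda>q. snd q j)"
    by (rule continuous_map_coord[OF j])
  show "continuous_map (tower_space X J) (tower_space X J) (\<lambda>q. set_coord j q t)" if t: "t \<in> cube" for t
  proof -
    have "continuous_map (tower_space X J) (product_topology (\<lambda>_. top_of_set cube) J) (\<lambda>q. (snd q)(j := t))"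
    proof (rule continuous_map_coordinatewise_then_product)
      show "continuous_map (tower_space X J) (top_of_set cube) (\<lambda>q. ((snd q)(j := t)) i)" if "i \<in> J" for i
        using that t continuous_map_coord[OF that] by (cases "i = j") auto
      show "((snd q)(j := t)) i = undefined" if "i \<notin> J" "q \<in> topspace (tower_space X J)" for i q
        using that j unfolding topspace_tower_space by (auto simp: PiE_iff extensional_def)
    qed
    moreover have "continuous_map (tower_space X J) X fst"
      unfolding tower_space_def by (rule continuous_map_fst)
    ultimately show ?thesis
      unfolding set_coord_def by (subst (2) tower_space_def) (rule continuous_map_pairedI)
  qed
  show "continuous_map (top_of_set cube) (tower_space X J) (set_coord j q)" if q: "q \<in> topspace (tower_space X J)" for q
  proof -
    have "continuous_map (top_of_set cube) (product_topology (\<lambda>_. top_of_set cube) J) (\<lambda>t. (snd q)(j := t))"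
    proof (rule continuous_map_coordinatewise_then_product)
      show "continuous_map (top_of_set cube) (top_of_set cube) (\<lambda>t. ((snd q)(j := t)) i)" if "i \<in> J" for i
        using that q unfolding topspace_tower_space by (cases "i = j") (auto simp: PiE_iff continuous_map_id[unfolded id_def])
      show "((snd q)(j := t)) i = undefined" if "i \<notin> J" for i t
        using that j q unfolding topspace_tower_space by (auto simp: PiE_iff extensional_def)
    qed
    moreover have "continuous_map (top_of_set cube) X (\<lambda>t. fst q)"
      using q unfolding topspace_tower_space by auto
    ultimately show ?thesis
      unfolding set_coord_def tower_space_def by (rule continuous_map_pairedI[rotated])
  qed
  show "snd (set_coord j q t) j = t" for q :: "'a \<times> ('j \<Rightarrow> nat \<Rightarrow> real)" and t
    unfolding set_coord_def by simp
  show "set_coord j q (snd q j) = q" for q :: "'a \<times> ('j \<Rightarrow> nat \<Rightarrow> real)"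
    unfolding set_coord_def by simp
  show "set_coord j (set_coord j q t) s = set_coord j q s" for q :: "'a \<times> ('j \<Rightarrow> nat \<Rightarrow> real)" and t s
    unfolding set_coord_def by simp
  show "fst (set_coord j q t) = fst q" for q :: "'a \<times> ('j \<Rightarrow> nat \<Rightarrow> real)" and t
    unfolding set_coord_def by simp
qed

text \<open>Membership in \<open>S\<close> survives changing any one coordinate of stage
  \<open>n\<close> or later. This is how an equation is restricted to data from earlier
  stages.\<close>

definition indep :: "'a topology \<Rightarrow> 'j set \<Rightarrow> ('j \<Rightarrow> nat) \<Rightarrow> nat \<Rightarrow> ('a \<times> ('j \<Rightarrow> nat \<Rightarrow> real)) set \<Rightarrow> bool" where
  "indep X J st n S \<longleftrightarrow> (\<forall>j\<in>J. n \<le> st j \<longrightarrow> coordinate.invariant (tower_space X J) (set_coord j) S)"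

lemma indep_closure: "indep X J st n S \<Longrightarrow> indep X J st n (tower_space X J closure_of S)"
  unfolding indep_def by (auto intro: coordinate.invariant_closure[OF coordinate_tower_space])

lemma indep_mono: "indep X J st n S \<Longrightarrow> n \<le> n' \<Longrightarrow> indep X J st n' S"
  unfolding indep_def by auto

text \<open>The data of \<open>R j\<close> do not see coordinates of stage \<open>st j\<close> or
  later, in particular neither \<open>j\<close> itself nor its companions of the same stage. The
  equations can therefore be treated one after another in order of stage.\<close>

locale tower =
  fixes X :: "'a topology" and J :: "'j set" and st :: "'j \<Rightarrow> nat"
    and R :: "'j \<Rightarrow> 'a \<times> ('j \<Rightarrow> nat \<Rightarrow> real) \<Rightarrow> (nat \<Rightarrow> real) \<Rightarrow> bool"
  assumes X: "continuum X"
    and step: "\<And>j. j \<in> J \<Longrightarrow>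
      (\<exists>U V. R j = zigzag (tower_space X J) U V \<and> openin (tower_space X J) U \<and> openin (tower_space X J) V \<and>
         indep X J st (st j) U \<and> indep X J st (st j) V \<and>
         tower_space X J closure_of U \<inter> tower_space X J closure_of V = {}) \<or>
      (\<exists>F m. R j = cover_graph F m \<and> topspace (tower_space X J) \<subseteq> (\<Union>i<m. F i) \<and>
         (\<forall>i<m. closedin (tower_space X J) (F i) \<and> indep X J st (st j) (F i)))"
begin

abbreviation "Q \<equiv> tower_space X J"

definition solutions :: "'j set \<Rightarrow> ('a \<times> ('j \<Rightarrow> nat \<Rightarrow> real)) set" where
  "solutions G = {q \<in> topspace Q. \<forall>j\<in>G. R j q (snd q j)}"

lemma closedin_constraint:
  assumes "j \<in> J"
  shows "closedin Q {q \<in> topspace Q. R j q (snd q j)}"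
proof -
  interpret coordinate Q X fst "\<lambda>q. snd q j" "set_coord j" by (rule coordinate_tower_space[OF assms])
  from step[OF assms] show ?thesis
  proof (elim disjE exE conjE)
    fix U V assume "R j = zigzag Q U V" "openin Q U" "openin Q V"
    then show ?thesis using closedin_zigzag by simp
  next
    fix F m assume "R j = cover_graph F m" "\<forall>i<m. closedin Q (F i) \<and> indep X J st (st j) (F i)"
    then show ?thesis using closedin_cover_graph by simp
  qed
qed

text \<open>The value \<open>t\<close> is an argument separate from \<open>q\<close>, so the claim
  also makes sense for \<open>j = k\<close>. Closures and frontiers of the data are covered by
  \<open>indep_closure\<close>.\<close>

lemma constraint_indep:
  assumes "j \<in> J" "k \<in> J" "st j \<le> st k" "q \<in> topspace Q" "s \<in> cube"
  shows "R j (set_coord k q s) t \<longleftrightarrow> R j q t"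
proof -
  interpret coordinate Q X fst "\<lambda>q. snd q k" "set_coord k" by (rule coordinate_tower_space[OF assms(2)])
  have iff: "set_coord k q s \<in> S \<longleftrightarrow> q \<in> S" if "indep X J st (st j) S" for S
    using that assms invariant_iff unfolding indep_def by blast
  from step[OF assms(1)] show ?thesis
  proof (elim disjE exE conjE)
    fix U V assume *: "R j = zigzag Q U V" "indep X J st (st j) U" "indep X J st (st j) V"
    show ?thesis
      unfolding *(1) zigzag_def Diff_iff
      by (simp only: iff[OF *(2)] iff[OF *(3)] iff[OF indep_closure[OF *(2)]] iff[OF indep_closure[OF *(3)]])
  next
    fix F m assume *: "R j = cover_graph F m" "\<forall>i<m. closedin Q (F i) \<and> indep X J st (st j) (F i)"
    then have "set_coord k q s \<in> F i \<longleftrightarrow> q \<in> F i" if "i < m" for i using iff that by blast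
    then show ?thesis unfolding *(1) cover_graph_def by blast
  qed
qed

text \<open>Coordinates are added in order of nondecreasing stage. The earlier equations do not see
  the new coordinate, so their solution set is invariant and one of the two one-coordinate transfers
  can be composed with the transfer already found.\<close>

lemma finite_transfer:
  assumes "finite G" "G \<subseteq> J"
  shows "\<exists>\<Phi>. transfer Q X fst (solutions G) \<Phi>"
  using assms
proof (induction G rule: finite_ranking_induct[where f = st])
  case empty
  \<comment> \<open>Without equations, the continuous section over the constant \<open>c0\<close>
    represents each fibre by one point and gives a transfer of degree one.\<close>
  define c0 :: "'j \<Rightarrow> nat \<Rightarrow> real" where "c0 = (\<lambda>j\<in>J. vertex 0)"
  define \<Phi> where "\<Phi> N = {x \<in> topspace X. (x, c0) \<in> N}" for N
  have c0: "c0 \<in> (\<Pi>\<^sub>E j\<in>J. cube)" unfolding c0_def by auto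
  have cont: "continuous_map X Q (\<lambda>x. (x, c0))"
    unfolding tower_space_def using c0 by (intro continuous_map_pairedI) auto
  have "transfer Q X fst (solutions {}) \<Phi>"
  proof
    show "\<Phi> A \<subseteq> fst ` A" for A unfolding \<Phi>_def by force
    show "topspace X \<subseteq> \<Phi> (solutions {})"
      unfolding \<Phi>_def solutions_def topspace_tower_space using c0 by auto
    show "closedin X (\<Phi> A)" if "closedin Q A" for A
      unfolding \<Phi>_def using closedin_continuous_map_preimage[OF cont that] .
  qed (auto simp: \<Phi>_def)
  then show ?case by blast
next
  case (insert j G)
  then obtain \<Phi> where T: "transfer Q X fst (solutions G) \<Phi>" by auto
  have jJ: "j \<in> J" using insert by simp
  interpret coordinate Q X fst "\<lambda>q. snd q j" "set_coord j" by (rule coordinate_tower_space[OF jJ])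
  have sol: "solutions (insert j G) = solutions G \<inter> {q \<in> topspace Q. R j q (snd q j)}"
    unfolding solutions_def by auto
  show ?case
  proof (cases "j \<in> G")
    case True
    then show ?thesis using T by (auto simp: insert_absorb)
  next
    case False
    have invariant: "invariant (solutions G)"
      unfolding invariant_def solutions_def
    proof (intro ballI)
      fix q t assume q: "q \<in> topspace Q" and t: "t \<in> cube"
      have "R k (set_coord j q t) (snd (set_coord j q t) k) \<longleftrightarrow> R k q (snd q k)" if k: "k \<in> G" for k
      proof -
        have "snd (set_coord j q t) k = snd q k" using k False unfolding set_coord_def by auto
        then show ?thesis using constraint_indep[of k j q t] insert k q t by auto
      qed
      then show "set_coord j q t \<in> {q \<in> topspace Q. \<forall>j\<in>G. R j q (snd q j)} \<longleftrightarrow>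
          q \<in> {q \<in> topspace Q. \<forall>j\<in>G. R j q (snd q j)}"
        using q upd_in[OF q t] by auto
    qed
    have sub: "solutions G \<subseteq> topspace Q" unfolding solutions_def by auto
    have ind: "invariant S" if "indep X J st (st j) S" for S using that jJ unfolding indep_def by auto
    from step[OF jJ] show ?thesis
    proof (elim disjE exE conjE)
      fix U V assume "R j = zigzag Q U V" "openin Q U" "openin Q V" "indep X J st (st j) U" "indep X J st (st j) V"
         "Q closure_of U \<inter> Q closure_of V = {}"
      then show ?thesis using zigzag_transfer[OF T invariant sub, of U V] ind sol by simp
    next
      fix F m assume "R j = cover_graph F m" "topspace Q \<subseteq> (\<Union>i<m. F i)"
         "\<forall>i<m. closedin Q (F i) \<and> indep X J st (st j) (F i)"
      then show ?thesis using cover_graph_transfer[OF T invariant sub, of m F] ind sol by simp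
    qed
  qed
qed

lemma closedin_solutions:
  assumes "G \<subseteq> J"
  shows "closedin Q (solutions G)"
proof (cases "G = {}")
  case True
  then show ?thesis unfolding solutions_def by simp
next
  case False
  then have eq: "solutions G = (\<Inter>j\<in>G. {q \<in> topspace Q. R j q (snd q j)})" unfolding solutions_def by auto
  show ?thesis
    unfolding eq
  proof (rule closedin_INT[OF False])
    show "closedin Q {q \<in> topspace Q. R j q (snd q j)}" if "j \<in> G" for j
      using closedin_constraint[of j] that assms by (simp add: subsetD)
  qed
qed

text \<open>The full solution set is the intersection of closed sets, one per equation. By
  compactness every open neighbourhood of it already contains the solutions of finitely many
  equations, and these carry a transfer.\<close>

theorem component:
  obtains C where "closedin Q C" "C \<subseteq> solutions J" "connectedin Q C"
    "\<And>K. subcontinuum X K \<Longrightarrow> \<exists>L\<subseteq>C. L \<noteq> {} \<and> compactin Q L \<and> connectedin Q L \<and> fst ` L = K"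
proof -
  have Q: "compact_space Q" "Hausdorff_space Q"
    using X compact_tower_space Hausdorff_tower_space unfolding continuum_def by auto
  show thesis
  proof (rule weakly_confluent_component[OF Q X _ closedin_solutions[OF subset_refl]])
    show "continuous_map Q X fst" unfolding tower_space_def by (rule continuous_map_fst)
    fix W assume W: "openin Q W" "solutions J \<subseteq> W"
    let ?\<U> = "insert W ((\<lambda>j. topspace Q - {q \<in> topspace Q. R j q (snd q j)}) ` J)"
    have "topspace Q \<subseteq> \<Union>?\<U>"
    proof
      fix q assume q: "q \<in> topspace Q"
      show "q \<in> \<Union>?\<U>"
      proof (cases "q \<in> solutions J")
        case False
        then obtain j where "j \<in> J" "\<not> R j q (snd q j)" using q unfolding solutions_def by auto
        then show ?thesis using q by auto
      qed (use W in auto)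
    qed
    moreover have "\<forall>U\<in>?\<U>. openin Q U" using W(1) closedin_constraint by auto
    ultimately have "\<exists>\<F>. finite \<F> \<and> \<F> \<subseteq> ?\<U> \<and> topspace Q \<subseteq> \<Union>\<F>"
      using Q(1) unfolding compact_space_alt by (elim allE[of _ ?\<U>] impE) simp_all
    then obtain \<F> where \<F>: "finite \<F>" "\<F> \<subseteq> ?\<U>" "topspace Q \<subseteq> \<Union>\<F>" by (elim exE conjE)
    have "\<F> - {W} \<subseteq> (\<lambda>j. topspace Q - {q \<in> topspace Q. R j q (snd q j)}) ` J" using \<F>(2) by auto
    then obtain G where G: "G \<subseteq> J" "finite G"
        "\<F> - {W} = (\<lambda>j. topspace Q - {q \<in> topspace Q. R j q (snd q j)}) ` G"
      using \<F>(1) by (meson finite_Diff finite_subset_image)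
    have "closedin Q (solutions G)" by (rule closedin_solutions[OF G(1)])
    moreover have "solutions G \<subseteq> W"
    proof
      fix q assume q: "q \<in> solutions G"
      then have "q \<in> topspace Q" "\<And>j. j \<in> G \<Longrightarrow> R j q (snd q j)" unfolding solutions_def by auto
      then have "q \<notin> \<Union>(\<F> - {W})" unfolding G(3) by auto
      then show "q \<in> W" using \<F>(3) \<open>q \<in> topspace Q\<close> by blast
    qed
    ultimately show "\<exists>Z \<Phi>. closedin Q Z \<and> Z \<subseteq> W \<and> transfer Q X fst Z \<Phi>"
      using finite_transfer[OF G(2,1)] by blast
  qed (rule that)
qed

end

section \<open>Crookedness and dimension\<close>

lemma open_base_closure:
  assumes B: "open_base Q \<B>" and Q: "compact_space Q" "Hausdorff_space Q"
    and G: "openin Q G" "q \<in> G"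
  obtains U where "U \<in> \<B>" "q \<in> U" "Q closure_of U \<subseteq> G"
proof -
  have "regular_space Q" using Q compact_Hausdorff_imp_regular_space by blast
  then obtain U0 V where U0: "openin Q U0" "closedin Q V" "q \<in> U0" "U0 \<subseteq> V" "V \<subseteq> G"
    using G unfolding neighbourhood_base_of_closedin[symmetric] neighbourhood_base_of by metis
  obtain \<S> where \<S>: "\<S> \<subseteq> \<B>" "\<Union>\<S> = U0" using B U0(1) unfolding open_base_def by metis
  then obtain U where "U \<in> \<S>" "q \<in> U" using U0(3) by blast
  moreover have "Q closure_of U \<subseteq> V"
    using \<open>U \<in> \<S>\<close> \<S> U0 by (intro closure_of_minimal) auto
  ultimately show thesis using that \<S>(1) U0(5) by blast
qed

lemma covering_dim_leE:
  assumes "covering_dim_le Y n" "finite \<U>" "\<And>U. U \<in> \<U> \<Longrightarrow> openin Y U" "\<Union>\<U> = topspace Y"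
  obtains \<V> where "finite \<V>" "\<And>V. V \<in> \<V> \<Longrightarrow> openin Y V" "\<Union>\<V> = topspace Y"
    "\<And>V. V \<in> \<V> \<Longrightarrow> \<exists>U\<in>\<U>. V \<subseteq> U" "\<And>x. x \<in> topspace Y \<Longrightarrow> card {V \<in> \<V>. x \<in> V} \<le> n + 1"
proof -
  have "\<exists>\<V>. finite \<V> \<and> (\<forall>V\<in>\<V>. openin Y V) \<and> \<Union>\<V> = topspace Y \<and> (\<forall>V\<in>\<V>. \<exists>U\<in>\<U>. V \<subseteq> U) \<and>
      (\<forall>x\<in>topspace Y. card {V \<in> \<V>. x \<in> V} \<le> n + 1)"
    using assms unfolding covering_dim_le_def by simp
  then obtain \<V> where v: "finite \<V>" "\<forall>V\<in>\<V>. openin Y V" "\<Union>\<V> = topspace Y" "\<forall>V\<in>\<V>. \<exists>U\<in>\<U>. V \<subseteq> U"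
      "\<forall>x\<in>topspace Y. card {V \<in> \<V>. x \<in> V} \<le> n + 1"
    by (elim exE conjE)
  show thesis by (rule that[OF v(1) bspec[OF v(2)] v(3) bspec[OF v(4)] bspec[OF v(5)]])
qed

text \<open>Refine the cover by the complements of \<open>a\<close> and of \<open>b\<close>. In a
  refinement of order one, members sharing a point coincide, so the member containing
  \<open>a\<close> is clopen and hence the whole space, although it must omit
  \<open>b\<close>.\<close>

lemma connected_not_covering_dim_le_0:
  assumes Y: "connected_space Y" "Hausdorff_space Y" and ab: "a \<in> topspace Y" "b \<in> topspace Y" "a \<noteq> b"
  shows "\<not> covering_dim_le Y 0"
proof
  assume dim: "covering_dim_le Y 0"
  let ?\<U> = "{topspace Y - {a}, topspace Y - {b}}"
  have U: "openin Y U" if "U \<in> ?\<U>" for U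
    using that ab Y(2) by (auto simp: closedin_Hausdorff_singleton)
  have U': "\<Union>?\<U> = topspace Y" "finite ?\<U>" using ab by auto
  obtain \<V> where \<V>: "finite \<V>" "\<And>V. V \<in> \<V> \<Longrightarrow> openin Y V" "\<Union>\<V> = topspace Y"
      "\<And>V. V \<in> \<V> \<Longrightarrow> \<exists>U\<in>?\<U>. V \<subseteq> U" and card: "\<And>x. x \<in> topspace Y \<Longrightarrow> card {V \<in> \<V>. x \<in> V} \<le> 0 + 1"
    by (rule covering_dim_leE[OF dim U'(2) U U'(1)]) (assumption | rule that)+
  obtain V where V: "V \<in> \<V>" "a \<in> V" using \<V>(3) ab(1) by blast
  have disj: "W = V" if "W \<in> \<V>" "x \<in> W" "x \<in> V" for W x
  proof -
    have "x \<in> topspace Y" using that(1,2) \<V>(3) by blast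
    from card[OF this] have "\<forall>S\<in>{V \<in> \<V>. x \<in> V}. \<forall>T\<in>{V \<in> \<V>. x \<in> V}. S = T"
      using \<V>(1) by (subst card_le_Suc0_iff_eq[symmetric]) auto
    then show ?thesis using that V(1) by simp
  qed
  have "topspace Y - V = \<Union>(\<V> - {V})" using \<V>(3) disj by auto
  then have "openin Y (topspace Y - V)" using \<V>(2) by (metis DiffD1 openin_Union)
  then have "closedin Y V" using \<V>(2)[OF V(1)] openin_subset unfolding closedin_def by blast
  then have "V = topspace Y" using Y(1) V \<V>(2) unfolding connected_space_clopen_in by blast
  then show False using \<V>(4)[OF V(1)] V(2) ab by auto
qed

lemma continuous_map_cube_coordinate: "continuous_map (top_of_set cube) euclideanreal (\<lambda>t. t l)"
  by (simp add: continuous_on_subset[OF continuous_on_product_coordinates])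

text \<open>The equations are exhaustive: each pair of basic sets with disjoint closures is folded
  somewhere, and each finite basic cover is resolved somewhere.\<close>

locale rich_tower = tower X J st R
  for X :: "'a topology" and J :: "'j set" and st R +
  fixes \<B>
  assumes base: "open_base Q \<B>"
    and zigzags: "\<And>U V. \<lbrakk>U \<in> \<B>; V \<in> \<B>; Q closure_of U \<inter> Q closure_of V = {}\<rbrakk>
      \<Longrightarrow> \<exists>j\<in>J. R j = zigzag Q U V"
    and covers: "\<And>\<F>. \<lbrakk>finite \<F>; \<F> \<subseteq> \<B>; topspace Q \<subseteq> \<Union>\<F>\<rbrakk>
      \<Longrightarrow> \<exists>j\<in>J. \<exists>m W. W ` {..<m} = \<F> \<and> R j = cover_graph (\<lambda>i. Q closure_of W i) m"
begin

lemma compact_Q: "compact_space Q" and Hausdorff_Q: "Hausdorff_space Q"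
  using X compact_tower_space Hausdorff_tower_space unfolding continuum_def by auto

lemma continuous_map_entry: "j \<in> J \<Longrightarrow> continuous_map Q euclideanreal (\<lambda>q. snd q j l)"
  using continuous_map_compose[OF continuous_map_coord continuous_map_cube_coordinate] by (simp add: o_def)

lemma entry_constant:
  assumes j: "j \<in> J" and P: "connectedin Q P" and e: "\<And>q. q \<in> P \<Longrightarrow> snd q j l = 0 \<or> snd q j l = 1"
    and a: "a \<in> P" "snd a j l = 1" and q: "q \<in> P"
  shows "snd q j l = 1"
proof -
  let ?S = "(\<lambda>q. snd q j l) ` P"
  have "connected ?S"
    using connectedin_continuous_map_image[OF continuous_map_entry[OF j] P] by simp
  moreover have "?S \<subseteq> {0, 1}" using e by auto
  then have "finite ?S" by (rule finite_subset) simp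
  ultimately have "?S = {} \<or> (\<exists>x. ?S = {x})" using connected_finite_iff_sing[of ?S] by simp
  then obtain x where "?S \<subseteq> {x}" by blast
  then have "snd a j l = x" "snd q j l = x" using a(1) q by (auto simp: image_subset_iff)
  then show ?thesis using a(2) by simp
qed

text \<open>Choose basic sets \<open>U\<close> around \<open>a\<close> and \<open>V\<close> around
  \<open>b\<close> with disjoint closures avoiding \<open>P2\<close> and \<open>P1\<close>
  respectively. Away from the closure of \<open>V\<close> sheet 0 is cut off from the others, so
  \<open>P1\<close> stays on it, starting from \<open>a\<close>. Symmetrically \<open>P2\<close>
  stays on sheet 2, starting from \<open>b\<close>. At a common point both would hold.\<close>

theorem subcontinua_nested:
  assumes P: "closedin Q P1" "closedin Q P2" "connectedin Q P1" "connectedin Q P2"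
    and sol: "P1 \<subseteq> solutions J" "P2 \<subseteq> solutions J" and meet: "P1 \<inter> P2 \<noteq> {}"
  shows "P1 \<subseteq> P2 \<or> P2 \<subseteq> P1"
proof (rule ccontr)
  assume "\<not> ?thesis"
  then obtain a b where ab: "a \<in> P1" "a \<notin> P2" "b \<in> P2" "b \<notin> P1" by blast
  have top: "P1 \<subseteq> topspace Q" "P2 \<subseteq> topspace Q" using P closedin_subset by auto
  obtain U where U: "U \<in> \<B>" "a \<in> U" "Q closure_of U \<subseteq> topspace Q - P2"
    using open_base_closure[OF base compact_Q Hausdorff_Q, of "topspace Q - P2" a] P(2) ab top by blast
  have "openin Q ((topspace Q - P1) - Q closure_of U)" using P(1) by (intro openin_diff) auto
  moreover have "b \<in> (topspace Q - P1) - Q closure_of U" using ab U(3) top by blast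
  ultimately obtain V where V: "V \<in> \<B>" "b \<in> V" "Q closure_of V \<subseteq> (topspace Q - P1) - Q closure_of U"
    by (rule open_base_closure[OF base compact_Q Hausdorff_Q])
  have sub: "U \<subseteq> Q closure_of U" "V \<subseteq> Q closure_of V"
    using U(1) V(1) base closure_of_subset openin_subset unfolding open_base_def by metis+
  have disj: "Q closure_of U \<inter> Q closure_of V = {}" using V(3) by blast
  then obtain j where j: "j \<in> J" "R j = zigzag Q U V" using zigzags U(1) V(1) by blast
  have z: "zigzag Q U V q (snd q j)" if "q \<in> solutions J" for q
    using that j unfolding solutions_def by auto
  have v: "vertex 0 0 = 1" "vertex 0 2 = 0" "vertex 1 0 = 0" "vertex 1 2 = 0" "vertex 2 0 = 0" "vertex 2 2 = 1"
    unfolding vertex_def by auto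
  have e: "t \<in> edge 1 2 \<Longrightarrow> t 0 = 0" "t \<in> edge 0 1 \<Longrightarrow> t 2 = 0" for t
    using edge_coordinates(1)[of t 1 2 0] edge_coordinates(1)[of t 0 1 2] by auto
  have c1: "snd q j = vertex 0 \<or> snd q j 0 = 0" if "q \<in> P1" for q
  proof -
    have "q \<notin> Q closure_of V" using that V(3) by blast
    moreover have "zigzag Q U V q (snd q j)" using z that sol(1) by blast
    ultimately show ?thesis using e v unfolding zigzag_def by auto
  qed
  have c2: "snd q j = vertex 2 \<or> snd q j 2 = 0" if "q \<in> P2" for q
  proof -
    have "q \<notin> Q closure_of U" using that U(3) by blast
    moreover have "zigzag Q U V q (snd q j)" using z that sol(2) by blast
    ultimately show ?thesis using e v unfolding zigzag_def by auto
  qed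
  have "zigzag Q U V a (snd a j)" "a \<notin> Q closure_of V" using z ab(1) sol(1) V(3) by blast+
  then have a1: "snd a j 0 = 1" using U(2) v unfolding zigzag_def by auto
  have "zigzag Q U V b (snd b j)" "b \<notin> Q closure_of U" using z ab(3) sol(2) U(3) by blast+
  then have b1: "snd b j 2 = 1" using V(2) v unfolding zigzag_def by auto
  obtain q where q: "q \<in> P1" "q \<in> P2" using meet by blast
  have "snd q j 0 = 1"
    by (rule entry_constant[OF j(1) P(3) _ ab(1) a1 q(1)]) (use c1 v in fastforce)
  moreover have "snd q j 2 = 1"
    by (rule entry_constant[OF j(1) P(4) _ ab(3) b1 q(2)]) (use c2 v in fastforce)
  ultimately show False using c1[OF q(1)] v by auto
qed

text \<open>Take a finite basic cover whose closures, cut down to \<open>C\<close>, refine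
  \<open>\<U>\<close>, and the coordinate resolving it. The open stars of the vertices refine the
  closures of the cover, and a point of an edge lies in at most two stars.\<close>

theorem covering_dim_solutions:
  assumes C: "closedin Q C" "C \<subseteq> solutions J"
  shows "covering_dim_le (subtopology Q C) 1"
  unfolding covering_dim_le_def
proof (intro allI impI; elim conjE)
  have topC: "topspace (subtopology Q C) = C" using C(1) closedin_subset by auto
  fix \<U> assume \<U>: "finite \<U>" "\<forall>U\<in>\<U>. openin (subtopology Q C) U" "\<Union>\<U> = topspace (subtopology Q C)"
  have small: "\<exists>W\<in>\<B>. q \<in> W \<and> (Q closure_of W \<inter> C = {} \<or> (\<exists>U\<in>\<U>. Q closure_of W \<inter> C \<subseteq> U))" if q: "q \<in> topspace Q" for q
  proof (cases "q \<in> C")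
    case True
    then obtain U where U: "U \<in> \<U>" "q \<in> U" using \<U>(3) topC by blast
    then obtain G where G: "openin Q G" "U = G \<inter> C" using \<U>(2) by (auto simp: openin_subtopology)
    have "q \<in> G" using U(2) G(2) by blast
    then obtain W where W: "W \<in> \<B>" "q \<in> W" "Q closure_of W \<subseteq> G"
      by (rule open_base_closure[OF base compact_Q Hausdorff_Q G(1)])
    then have "Q closure_of W \<inter> C \<subseteq> U" using G(2) by blast
    then show ?thesis using U(1) W by (intro bexI[of _ W] conjI disjI2 bexI[of _ U])
  next
    case False
    have "openin Q (topspace Q - C)" "q \<in> topspace Q - C" using C(1) q False by auto
    then obtain W where W: "W \<in> \<B>" "q \<in> W" "Q closure_of W \<subseteq> topspace Q - C"
      by (rule open_base_closure[OF base compact_Q Hausdorff_Q])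
    then have "Q closure_of W \<inter> C = {}" by blast
    then show ?thesis using W by (intro bexI[of _ W] conjI disjI1)
  qed
  let ?\<W> = "{W \<in> \<B>. Q closure_of W \<inter> C = {} \<or> (\<exists>U\<in>\<U>. Q closure_of W \<inter> C \<subseteq> U)}"
  have "\<forall>W\<in>?\<W>. openin Q W" using base unfolding open_base_def by blast
  moreover have "topspace Q \<subseteq> \<Union>?\<W>" using small by blast
  ultimately have "\<exists>\<F>. finite \<F> \<and> \<F> \<subseteq> ?\<W> \<and> topspace Q \<subseteq> \<Union>\<F>"
    using compact_Q unfolding compact_space_alt by (elim allE[of _ ?\<W>] impE) simp_all
  then obtain \<F> where \<F>: "finite \<F>" "\<F> \<subseteq> ?\<W>" "topspace Q \<subseteq> \<Union>\<F>" by (elim exE conjE)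
  obtain j m W where j: "j \<in> J" "W ` {..<m} = \<F>" "R j = cover_graph (\<lambda>i. Q closure_of W i) m"
    using covers[OF \<F>(1) _ \<F>(3)] \<F>(2) by blast
  define V where "V i = {q \<in> C. 0 < snd q j i}" for i
  have sol: "\<exists>i<m. \<exists>k<m. q \<in> Q closure_of W i \<and> q \<in> Q closure_of W k \<and> snd q j \<in> edge i k" if "q \<in> C" for q
  proof -
    have "R j q (snd q j)" using that C(2) j(1) unfolding solutions_def by blast
    then show ?thesis unfolding j(3) cover_graph_def .
  qed
  have VW: "i < m \<and> V i \<subseteq> Q closure_of W i \<inter> C" if ne: "V i \<noteq> {}" for i
  proof -
    have *: "i < m \<and> q \<in> Q closure_of W i" if q: "q \<in> V i" for q
    proof -
      from q have "q \<in> C" "0 < snd q j i" unfolding V_def by auto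
      with sol obtain i' k where ik: "i' < m" "k < m" "q \<in> Q closure_of W i'" "q \<in> Q closure_of W k" "snd q j \<in> edge i' k"
        by blast
      have "i = i' \<or> i = k" using edge_coordinates(1)[OF ik(5), of i] \<open>0 < snd q j i\<close> by fastforce
      then show ?thesis using ik by auto
    qed
    then show ?thesis using ne unfolding V_def by blast
  qed
  let ?\<V> = "V ` {i. i < m \<and> V i \<noteq> {}}"
  have "finite ?\<V>" by auto
  moreover have "openin (subtopology Q C) (V i)" for i
  proof -
    have "openin Q {q \<in> topspace Q. snd q j i \<in> {0<..}}"
      by (rule openin_continuous_map_preimage[OF continuous_map_entry[OF j(1)]]) simp
    moreover have "V i = {q \<in> topspace Q. snd q j i \<in> {0<..}} \<inter> C"
      unfolding V_def using closedin_subset[OF C(1)] by auto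
    ultimately show ?thesis by (auto simp: openin_subtopology)
  qed
  then have "\<forall>S\<in>?\<V>. openin (subtopology Q C) S" by blast
  moreover have "\<Union>?\<V> = topspace (subtopology Q C)"
    unfolding topC
  proof (intro equalityI subsetI)
    fix q assume q: "q \<in> C"
    then obtain i k where ik: "i < m" "k < m" "snd q j \<in> edge i k" using sol by blast
    then obtain l where "l \<in> {i, k}" "0 < snd q j l" using edge_coordinates(4) by blast
    then have "q \<in> V l" "l < m" using q ik unfolding V_def by auto
    then show "q \<in> \<Union>?\<V>" by blast
  qed (auto simp: V_def)
  moreover have "\<forall>S\<in>?\<V>. \<exists>U\<in>\<U>. S \<subseteq> U"
  proof
    fix S assume "S \<in> ?\<V>"
    then obtain i where i: "i < m" "V i \<noteq> {}" "S = V i" by auto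
    have "W i \<in> ?\<W>" using i(1) j(2) \<F>(2) by blast
    then show "\<exists>U\<in>\<U>. S \<subseteq> U" using VW[OF i(2)] i(2,3) by blast
  qed
  moreover have "card {S \<in> ?\<V>. q \<in> S} \<le> 1 + 1" if q: "q \<in> C" for q
  proof -
    obtain i k where ik: "snd q j \<in> edge i k" using sol[OF q] by blast
    have "{S \<in> ?\<V>. q \<in> S} \<subseteq> {V i, V k}"
    proof
      fix S assume "S \<in> {S \<in> ?\<V>. q \<in> S}"
      then obtain l where l: "S = V l" "0 < snd q j l" unfolding V_def by auto
      then have "l = i \<or> l = k" using edge_coordinates(1)[OF ik, of l] by fastforce
      then show "S \<in> {V i, V k}" using l by auto
    qed
    then have "card {S \<in> ?\<V>. q \<in> S} \<le> card {V i, V k}" by (rule card_mono[rotated]) simp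
    also have "\<dots> \<le> 2" by (simp add: card_insert_if)
    finally show ?thesis by simp
  qed
  ultimately show "\<exists>\<V>. finite \<V> \<and> (\<forall>V\<in>\<V>. openin (subtopology Q C) V) \<and> \<Union>\<V> = topspace (subtopology Q C) \<and>
      (\<forall>V\<in>\<V>. \<exists>U\<in>\<U>. V \<subseteq> U) \<and> (\<forall>x\<in>topspace (subtopology Q C). card {V \<in> \<V>. x \<in> V} \<le> 1 + 1)"
    unfolding topC by (intro exI[of _ ?\<V>] conjI ballI) auto
qed

end

section \<open>Cardinality of open bases\<close>

unbundle cardinal_syntax

lemma card_of_image_ordLeq: "|A| \<le>o r \<Longrightarrow> |f ` A| \<le>o r"
  using card_of_image ordLeq_transitive by blast

lemma card_of_Un_ordLeq_infinite: "infinite D \<Longrightarrow> |A| \<le>o |D| \<Longrightarrow> |B| \<le>o |D| \<Longrightarrow> |A \<union> B| \<le>o |D|"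
  by (rule card_of_Un_ordLeq_infinite_Field[OF _ _ _ card_of_Card_order]) (simp_all add: Field_card_of)

lemma card_of_Times_ordLeq_infinite:
  assumes "infinite D" "|A| \<le>o |D|" "|B| \<le>o |D|"
  shows "|A \<times> B| \<le>o |D|"
proof -
  have "A \<times> B = (\<Union>a\<in>A. Pair a ` B)" by auto
  then show ?thesis
    using card_of_UNION_ordLeq_infinite[OF assms(1,2), of "\<lambda>a. Pair a ` B"] card_of_image_ordLeq[OF assms(3)] by auto
qed

text \<open>Lists of each fixed length are bounded by induction, and there are countably many
  lengths. Lists serve below as codes for finite families.\<close>

lemma card_of_lists_ordLeq_infinite:
  assumes D: "infinite D" and A: "|A| \<le>o |D|"
  shows "|lists A| \<le>o |D|"
proof -
  have nat: "|UNIV :: nat set| \<le>o |D|" using D infinite_iff_card_of_nat by blast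
  have "|{l \<in> lists A. length l = n}| \<le>o |D|" for n
  proof (induction n)
    case 0
    have "{l \<in> lists A. length l = 0} = (\<lambda>_::nat. []) ` UNIV" by auto
    then show ?case using card_of_image_ordLeq[OF nat, of "\<lambda>_. []"] by simp
  next
    case (Suc n)
    have "{l \<in> lists A. length l = Suc n} = (\<Union>a\<in>A. (#) a ` {l \<in> lists A. length l = n})"
      by (auto simp: length_Suc_conv image_iff)
    then show ?case
      using card_of_UNION_ordLeq_infinite[OF D A, of "\<lambda>a. (#) a ` {l \<in> lists A. length l = n}"]
        card_of_image_ordLeq[OF Suc] by auto
  qed
  then have "|\<Union>n\<in>UNIV. {l \<in> lists A. length l = n}| \<le>o |D|"
    by (intro card_of_UNION_ordLeq_infinite[OF D nat] ballI)
  moreover have "(\<Union>n\<in>UNIV. {l \<in> lists A. length l = n}) = lists A" by auto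
  ultimately show ?thesis by simp
qed

lemma open_baseI:
  assumes "\<And>W. W \<in> \<B> \<Longrightarrow> openin Y W"
    and "\<And>G q. openin Y G \<Longrightarrow> q \<in> G \<Longrightarrow> \<exists>W\<in>\<B>. q \<in> W \<and> W \<subseteq> G"
  shows "open_base Y \<B>"
  unfolding open_base_def
proof (intro conjI ballI allI impI)
  fix G assume "openin Y G"
  then have "\<Union>{W \<in> \<B>. W \<subseteq> G} = G" using assms(2) by blast
  then show "\<exists>\<S>\<subseteq>\<B>. \<Union>\<S> = G" by (metis (no_types, lifting) mem_Collect_eq subsetI)
qed (rule assms(1))

lemma open_baseD:
  assumes "open_base Y \<B>"
  shows "W \<in> \<B> \<Longrightarrow> openin Y W" "openin Y G \<Longrightarrow> q \<in> G \<Longrightarrow> \<exists>W\<in>\<B>. q \<in> W \<and> W \<subseteq> G"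
proof -
  show "openin Y W" if "W \<in> \<B>" using assms that unfolding open_base_def by blast
  assume "openin Y G" "q \<in> G"
  then obtain \<S> where "\<S> \<subseteq> \<B>" "\<Union>\<S> = G" using assms unfolding open_base_def by metis
  then show "\<exists>W\<in>\<B>. q \<in> W \<and> W \<subseteq> G" using \<open>q \<in> G\<close> by blast
qed

section \<open>Weight of compact Hausdorff spaces\<close>

text \<open>Fix one separation \<open>U x y\<close>, \<open>V x y\<close> for every pair of points.
  For \<open>x\<close> in an open \<open>G\<close>, finitely many \<open>V x y\<close> cover the
  compact complement of \<open>G\<close>, and the intersection of the matching \<open>U x y\<close>
  lies in \<open>G\<close>. Finite intersections indexed by pairs of points therefore form a
  base.\<close>

lemma compact_Hausdorff_small_base:
  fixes X :: "'a topology"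
  assumes X: "compact_space X" "Hausdorff_space X"
  shows "\<exists>\<B>. open_base X \<B> \<and> |\<B>| \<le>o |UNIV :: ('a + nat) set|"
proof -
  have inf: "infinite (UNIV :: ('a + nat) set)" by simp
  have a: "|UNIV :: 'a set| \<le>o |UNIV :: ('a + nat) set|" by (rule card_of_ordLeqI[of Inl]) auto
  define P where "P x y W \<longleftrightarrow> openin X (fst W) \<and> openin X (snd W) \<and> x \<in> fst W \<and> y \<in> snd W \<and> fst W \<inter> snd W = {}"
    for x y and W :: "'a set \<times> 'a set"
  define U V where "U x y = fst (SOME W. P x y W)" and "V x y = snd (SOME W. P x y W)" for x y
  have UV: "openin X (U x y) \<and> openin X (V x y) \<and> x \<in> U x y \<and> y \<in> V x y \<and> U x y \<inter> V x y = {}"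
    if "x \<in> topspace X" "y \<in> topspace X" "x \<noteq> y" for x y
  proof -
    have "\<exists>U V. openin X U \<and> openin X V \<and> x \<in> U \<and> y \<in> V \<and> disjnt U V"
      using X(2) that unfolding Hausdorff_space_def by simp
    then obtain U' V' where "openin X U'" "openin X V'" "x \<in> U'" "y \<in> V'" "disjnt U' V'"
      by (elim exE conjE)
    then have "P x y (U', V')" unfolding P_def disjnt_def by simp
    then have "P x y (SOME W. P x y W)" by (rule someI)
    then show ?thesis unfolding U_def V_def P_def .
  qed
  define \<S> where "\<S> = (\<lambda>(x, y). U x y) ` {(x, y). x \<in> topspace X \<and> y \<in> topspace X \<and> x \<noteq> y}"
  define \<B> where "\<B> = (\<lambda>l. topspace X \<inter> \<Inter>(set l)) ` lists \<S>"
  have "|{(x, y). x \<in> topspace X \<and> y \<in> topspace X \<and> x \<noteq> y}| \<le>o |UNIV :: ('a + nat) set|"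
    by (rule ordLeq_transitive[OF card_of_mono1 card_of_Times_ordLeq_infinite[OF inf a a]]) auto
  then have "|\<B>| \<le>o |UNIV :: ('a + nat) set|"
    unfolding \<B>_def \<S>_def by (intro card_of_image_ordLeq card_of_lists_ordLeq_infinite inf)
  moreover have "open_base X \<B>"
  proof (rule open_baseI)
    have S: "openin X S" if "S \<in> \<S>" for S using that UV unfolding \<S>_def by auto
    show "openin X W" if W: "W \<in> \<B>" for W
    proof -
      obtain l where l: "W = topspace X \<inter> \<Inter>(set l)" "set l \<subseteq> \<S>" using W unfolding \<B>_def by auto
      have "openin X (topspace X \<inter> \<Inter>(set l))" using l(2)
        by (induction l) (use S in \<open>auto simp: Int_left_commute[of "topspace X"]\<close>)
      then show ?thesis using l by simp
    qed
    fix G x assume G: "openin X G" "x \<in> G"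
    then have x: "x \<in> topspace X" using openin_subset by blast
    have "compactin X (topspace X - G)" using G X closedin_compact_space by blast
    then have "\<exists>\<F>. finite \<F> \<and> \<F> \<subseteq> V x ` (topspace X - G) \<and> topspace X - G \<subseteq> \<Union>\<F>"
    proof (rule compactinD)
      show "openin X W" if "W \<in> V x ` (topspace X - G)" for W using that UV x G by auto
      show "topspace X - G \<subseteq> \<Union>(V x ` (topspace X - G))" using UV x G by blast
    qed
    then obtain \<F> where \<F>: "finite \<F>" "\<F> \<subseteq> V x ` (topspace X - G)" "topspace X - G \<subseteq> \<Union>\<F>"
      by (elim exE conjE)
    obtain F where F: "finite F" "F \<subseteq> topspace X - G" "\<F> = V x ` F"
      using finite_subset_image[OF \<F>(1,2)] by blast
    obtain l where l: "set l = U x ` F" using finite_list[OF finite_imageI[OF F(1), of "U x"]] by (elim exE)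
    have "U x y \<in> \<S>" if "y \<in> F" for y
      unfolding \<S>_def using that F(2) x G(2) by (intro image_eqI[of _ _ "(x, y)"]) auto
    then have "topspace X \<inter> \<Inter>(set l) \<in> \<B>" unfolding \<B>_def using l by (intro imageI) auto
    moreover have "x \<in> U x y" if "y \<in> F" for y
      using UV[OF x, of y] that F(2) G(2) by blast
    then have "x \<in> topspace X \<inter> \<Inter>(set l)" using x l by auto
    moreover have "topspace X \<inter> \<Inter>(set l) \<subseteq> G"
    proof
      fix y assume y: "y \<in> topspace X \<inter> \<Inter>(set l)"
      show "y \<in> G"
      proof (rule ccontr)
        assume "y \<notin> G"
        then obtain z where z: "z \<in> F" "y \<in> V x z" using y \<F>(3) F(3) by blast
        then have "y \<in> U x z" using y l by auto
        moreover have "U x z \<inter> V x z = {}" using UV[of x z] x z F(2) G(2) by auto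
        ultimately show False using z by auto
      qed
    qed
    ultimately show "\<exists>W\<in>\<B>. x \<in> W \<and> W \<subseteq> G" by blast
  qed
  ultimately show ?thesis by blast
qed

text \<open>Cardinals are well-ordered, so the least size of a base is attained. A construction
  bounded by this base is bounded by every base, as \<open>weight_le\<close> demands.\<close>

lemma minimal_open_base:
  fixes X :: "'a topology"
  assumes X: "compact_space X" "Hausdorff_space X"
  obtains B where "open_base X B" "|B| \<le>o |UNIV :: ('a + nat) set|" "\<And>B'. open_base X B' \<Longrightarrow> |B| \<le>o |B'|"
proof -
  obtain B0 where B0: "open_base X B0" "|B0| \<le>o |UNIV :: ('a + nat) set|"
    using compact_Hausdorff_small_base[OF X] by blast
  let ?R = "card_of ` {B. open_base X B}"
  have "\<exists>r\<in>?R. \<forall>r'\<in>?R. r \<le>o r'"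
    by (rule exists_minim_Card_order) (use B0 card_of_Card_order in auto)
  then obtain B where B: "open_base X B" "\<And>B'. open_base X B' \<Longrightarrow> |B| \<le>o |B'|" by auto
  show thesis using that[OF B(1) _ B(2)] B(2)[OF B0(1)] B0(2) ordLeq_transitive by blast
qed

text \<open>The map is closed, so the points whose whole fibre lies in a finite union of basic sets
  form an open set. Compactness of fibres shows that these sets are a base of
  \<open>X\<close>.\<close>

lemma weight_le_continuous_image:
  assumes Y: "compact_space Y" and X: "Hausdorff_space X" and f: "continuous_map Y X f" "f ` topspace Y = topspace X"
  shows "weight_le X Y"
  unfolding weight_le_def
proof (intro allI impI)
  fix \<B> assume B: "open_base Y \<B>"
  let ?D = "\<B> <+> (UNIV :: nat set)"
  have D: "infinite ?D" by simp
  define \<C> where "\<C> = (\<lambda>l. topspace X - f ` (topspace Y - \<Union>(set l))) ` lists \<B>"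
  have "|\<C>| \<le>o |?D|"
    unfolding \<C>_def by (intro card_of_image_ordLeq card_of_lists_ordLeq_infinite D card_of_Plus1)
  moreover have "open_base X \<C>"
  proof (rule open_baseI)
    have cl: "closed_map Y X f" using continuous_imp_closed_map[OF f(1) Y X] .
    show "openin X W" if W: "W \<in> \<C>" for W
    proof -
      obtain l where l: "W = topspace X - f ` (topspace Y - \<Union>(set l))" "set l \<subseteq> \<B>" using W unfolding \<C>_def by auto
      have "openin Y (\<Union>(set l))" using l(2) open_baseD(1)[OF B] by blast
      then have "closedin X (f ` (topspace Y - \<Union>(set l)))" using cl unfolding closed_map_def by blast
      then show ?thesis using l(1) by blast
    qed
    fix G x assume G: "openin X G" "x \<in> G"
    then have x: "x \<in> topspace X" using openin_subset by blast
    let ?P = "{y \<in> topspace Y. f y \<in> {x}}" and ?G' = "{y \<in> topspace Y. f y \<in> G}"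
    have "closedin Y ?P"
      using closedin_continuous_map_preimage[OF f(1)] closedin_Hausdorff_singleton[OF X x] by blast
    then have P: "compactin Y ?P" using Y closedin_compact_space by blast
    have G': "openin Y ?G'" using openin_continuous_map_preimage[OF f(1) G(1)] .
    have "?P \<subseteq> \<Union>{W \<in> \<B>. W \<subseteq> ?G'}"
    proof
      fix y assume "y \<in> ?P"
      then have "y \<in> ?G'" using G(2) by auto
      then show "y \<in> \<Union>{W \<in> \<B>. W \<subseteq> ?G'}" using open_baseD(2)[OF B G'] by blast
    qed
    with P have "\<exists>\<F>. finite \<F> \<and> \<F> \<subseteq> {W \<in> \<B>. W \<subseteq> ?G'} \<and> ?P \<subseteq> \<Union>\<F>"
      using open_baseD(1)[OF B] by (intro compactinD) auto
    then obtain \<F> where \<F>: "finite \<F>" "\<F> \<subseteq> {W \<in> \<B>. W \<subseteq> ?G'}" "?P \<subseteq> \<Union>\<F>"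
      by (elim exE conjE)
    obtain l where l: "set l = \<F>" using finite_list[OF \<F>(1)] by (elim exE)
    let ?W = "topspace X - f ` (topspace Y - \<Union>(set l))"
    have "?W \<in> \<C>" unfolding \<C>_def using l \<F>(2) by (intro imageI) auto
    moreover have "x \<in> ?W" using x \<F>(3) l by auto
    moreover have "?W \<subseteq> G"
    proof
      fix z assume z: "z \<in> ?W"
      then obtain y where y: "y \<in> topspace Y" "z = f y" using f(2) by blast
      then have "y \<in> \<Union>(set l)" using z by auto
      then show "z \<in> G" using y l \<F>(2) by auto
    qed
    ultimately show "\<exists>W\<in>\<C>. x \<in> W \<and> W \<subseteq> G" by blast
  qed
  ultimately show "\<exists>\<C>. open_base X \<C> \<and> |\<C>| \<le>o |?D|" by blast
qed

section \<open>Boxes as a base of the tower space\<close>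

lemma subcontinuum_subtopology:
  "closedin Q C \<Longrightarrow> subcontinuum (subtopology Q C) L \<longleftrightarrow> subcontinuum Q L \<and> L \<subseteq> C"
  unfolding subcontinuum_def compactin_subtopology connectedin_subtopology
  using closedin_subset by auto

text \<open>The two points of \<open>X\<close> enter only through the dimension: they have distinct
  preimages in \<open>C\<close>, and a connected space with two points is not
  zero-dimensional.\<close>

lemma (in rich_tower) hereditarily_indecomposable_preimage:
  assumes ab: "a \<in> topspace X" "b \<in> topspace X" "a \<noteq> b"
  obtains C where "closedin Q C" "continuum (subtopology Q C)" "hereditarily_indecomposable (subtopology Q C)"
    "covering_dim_eq (subtopology Q C) 1" "weakly_confluent (subtopology Q C) X fst"
proof -
  obtain C where C: "closedin Q C" "C \<subseteq> solutions J" "connectedin Q C"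
    and lift: "\<And>K. subcontinuum X K \<Longrightarrow> \<exists>L\<subseteq>C. L \<noteq> {} \<and> compactin Q L \<and> connectedin Q L \<and> fst ` L = K"
    by (rule component) blast
  let ?Y = "subtopology Q C"
  have XX: "topspace X \<noteq> {}" "compact_space X" "connected_space X" "Hausdorff_space X"
    using X unfolding continuum_def by auto
  have topC: "topspace ?Y = C" using C(1) closedin_subset by auto
  have cont: "continuous_map ?Y X fst"
    unfolding tower_space_def by (intro continuous_map_from_subtopology continuous_map_fst)
  have "subcontinuum X (topspace X)"
    unfolding subcontinuum_def using XX compact_space_def by (auto simp: connectedin_topspace)
  from lift[OF this] obtain L where L: "L \<subseteq> C" "fst ` L = topspace X" by blast
  have surj: "fst ` C = topspace X"
    using L cont topC continuous_map_image_subset_topspace by (metis image_mono subset_antisym)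
  have comp: "compact_space ?Y" using C(1) compact_Q closedin_compact_space compact_space_subtopology by blast
  have haus: "Hausdorff_space ?Y" using Hausdorff_Q Hausdorff_space_subtopology by blast
  have conn: "connected_space ?Y" using C(3) unfolding connectedin_def by blast
  have "a \<in> fst ` C" "b \<in> fst ` C" using ab surj by auto
  then obtain a' b' where "a = fst a'" "a' \<in> C" "b = fst b'" "b' \<in> C" by (elim imageE)
  then have ab': "a' \<in> C" "b' \<in> C" "a' \<noteq> b'" using ab(3) by auto
  have 1: "continuum ?Y" unfolding continuum_def using comp haus conn topC ab' by auto
  have 2: "hereditarily_indecomposable ?Y"
    unfolding hereditarily_indecomposable_def
  proof (intro conjI comp haus allI impI)
    fix A B assume "subcontinuum ?Y A \<and> subcontinuum ?Y B \<and> A \<inter> B \<noteq> {}"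
    then have *: "subcontinuum Q A" "subcontinuum Q B" "A \<subseteq> C" "B \<subseteq> C" "A \<inter> B \<noteq> {}"
      by (simp_all add: subcontinuum_subtopology[OF C(1)])
    then have "closedin Q A" "closedin Q B" "connectedin Q A" "connectedin Q B"
      using compactin_imp_closedin[OF Hausdorff_Q] unfolding subcontinuum_def by auto
    then show "A \<subseteq> B \<or> B \<subseteq> A" using subcontinua_nested[of A B] * C(2) by (meson order_trans)
  qed
  have 3: "covering_dim_eq ?Y 1"
    unfolding covering_dim_eq_def
    using covering_dim_solutions[OF C(1,2)] connected_not_covering_dim_le_0[OF conn haus, of a' b'] ab' topC by auto
  have 4: "weakly_confluent ?Y X fst"
    unfolding weakly_confluent_def topC
  proof (intro conjI cont surj allI impI)
    fix K assume "subcontinuum X K"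
    from lift[OF this] obtain L where L: "L \<subseteq> C" "L \<noteq> {}" "compactin Q L" "connectedin Q L" "fst ` L = K"
      by blast
    then have "subcontinuum Q L"
      unfolding subcontinuum_def using compactin_subset_topspace by blast
    then have "subcontinuum ?Y L" using L(1) by (simp add: subcontinuum_subtopology[OF C(1)])
    then show "\<exists>L. subcontinuum ?Y L \<and> fst ` L = K" using L(5) by blast
  qed
  show thesis by (rule that[OF C(1) 1 2 3 4])
qed

text \<open>Finite intersections of subbasic cylinders, coded by lists to make counting easy. The
  leading factor gives the empty list the whole space as value.\<close>

definition boxes :: "'a topology \<Rightarrow> 'j set \<Rightarrow> 'a set set \<Rightarrow> (nat \<Rightarrow> real) set set \<Rightarrow> ('a \<times> ('j \<Rightarrow> nat \<Rightarrow> real)) set set" where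
  "boxes X J B \<C> = (\<lambda>l. topspace (tower_space X J) \<inter> \<Inter>(set l)) `
     lists ((\<lambda>b. {q. fst q \<in> b}) ` B \<union> (\<Union>j\<in>J. (\<lambda>c. {q. snd q j \<in> c}) ` \<C>))"

lemma boxes_card:
  assumes "infinite D" "|B| \<le>o |D|" "|J| \<le>o |D|" "|\<C>| \<le>o |D|"
  shows "|boxes X J B \<C>| \<le>o |D|"
  unfolding boxes_def
  using assms
  by (intro card_of_image_ordLeq card_of_lists_ordLeq_infinite card_of_Un_ordLeq_infinite
      card_of_UNION_ordLeq_infinite ballI)

lemma openin_boxes:
  assumes B: "\<And>b. b \<in> B \<Longrightarrow> openin X b" and C: "\<And>c. c \<in> \<C> \<Longrightarrow> open c" and W: "W \<in> boxes X J B \<C>"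
  shows "openin (tower_space X J) W"
proof -
  let ?Q = "tower_space X J"
  let ?S = "(\<lambda>b. {q. fst q \<in> b}) ` B \<union> (\<Union>j\<in>J. (\<lambda>c. {q. snd q j \<in> c}) ` \<C>)"
  have S: "openin ?Q (topspace ?Q \<inter> s)" if "s \<in> ?S" for s
    using that
  proof
    assume "s \<in> (\<lambda>b. {q. fst q \<in> b}) ` B"
    then obtain b where b: "b \<in> B" "s = {q. fst q \<in> b}" by auto
    have "openin ?Q {q \<in> topspace ?Q. fst q \<in> b}"
      by (rule openin_continuous_map_preimage[OF _ B[OF b(1)]]) (simp add: tower_space_def continuous_map_fst)
    then show ?thesis unfolding b(2) by (simp add: Int_def)
  next
    assume "s \<in> (\<Union>j\<in>J. (\<lambda>c. {q. snd q j \<in> c}) ` \<C>)"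
    then obtain j c where j: "j \<in> J" "c \<in> \<C>" "s = {q. snd q j \<in> c}" by auto
    have "openin ?Q {q \<in> topspace ?Q. snd q j \<in> c}"
      by (rule openin_continuous_map_preimage[OF continuous_map_into_fulltopology[OF continuous_map_coord[OF j(1)]]])
        (simp add: C[OF j(2)])
    then show ?thesis unfolding j(3) by (simp add: Int_def)
  qed
  obtain l where l: "W = topspace ?Q \<inter> \<Inter>(set l)" "set l \<subseteq> ?S" using W unfolding boxes_def lists_eq_set by blast
  have "openin ?Q (topspace ?Q \<inter> \<Inter>(set l))" using l(2)
  proof (induction l)
    case (Cons s l)
    have "topspace ?Q \<inter> \<Inter>(set (s # l)) = (topspace ?Q \<inter> s) \<inter> (topspace ?Q \<inter> \<Inter>(set l))" by auto
    then show ?case using Cons S by (simp add: openin_Int)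
  qed simp
  then show ?thesis using l(1) by simp
qed

lemma open_base_boxes:
  assumes B: "open_base X B" and C: "topological_basis \<C>"
  shows "open_base (tower_space X J) (boxes X J B \<C>)"
proof (rule open_baseI)
  let ?Q = "tower_space X J"
  let ?S = "(\<lambda>b. {q. fst q \<in> b}) ` B \<union> (\<Union>j\<in>J. (\<lambda>c. {q. snd q j \<in> c}) ` \<C>)"
  show "openin ?Q W" if "W \<in> boxes X J B \<C>" for W
    by (rule openin_boxes[OF open_baseD(1)[OF B] topological_basis_open[OF C] that])
  fix G q assume G: "openin ?Q G" "q \<in> G"
  obtain x f where q: "q = (x, f)" by (cases q)
  obtain U V where UV: "openin X U" "openin (product_topology (\<lambda>_. top_of_set cube) J) V" "x \<in> U" "f \<in> V" "U \<times> V \<subseteq> G"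
    using G(1)[unfolded tower_space_def openin_prod_topology_alt, rule_format, OF G(2)[unfolded q]]
    by (elim exE conjE)
  obtain b where b: "b \<in> B" "x \<in> b" "b \<subseteq> U" using open_baseD(2)[OF B UV(1,3)] by blast
  obtain T where T: "finite {j \<in> J. T j \<noteq> topspace (top_of_set cube)}" "\<forall>j\<in>J. openin (top_of_set cube) (T j)"
      "f \<in> Pi\<^sub>E J T" "Pi\<^sub>E J T \<subseteq> V"
    using bspec[OF UV(2)[unfolded openin_product_topology_alt] UV(4)] by (elim exE conjE)
  let ?F = "{j \<in> J. T j \<noteq> cube}"
  have fin: "finite ?F" using T(1) by simp
  have "\<exists>c. c \<in> \<C> \<and> f j \<in> c \<and> c \<inter> cube \<subseteq> T j" if j: "j \<in> J" for j
  proof -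
    obtain S where S: "open S" "T j = cube \<inter> S" using bspec[OF T(2) j] unfolding openin_open by blast
    have "f j \<in> S" using T(3) j S(2) by (auto simp: PiE_iff)
    then obtain c where "c \<in> \<C>" "f j \<in> c" "c \<subseteq> S" using topological_basisE[OF C S(1)] by blast
    then show ?thesis using S(2) by blast
  qed
  then obtain c where c: "\<And>j. j \<in> J \<Longrightarrow> c j \<in> \<C> \<and> f j \<in> c j \<and> c j \<inter> cube \<subseteq> T j" by metis
  obtain l where l: "set l = insert {q. fst q \<in> b} ((\<lambda>j. {q. snd q j \<in> c j}) ` ?F)"
    using finite_list[of "insert {q. fst q \<in> b} ((\<lambda>j. {q. snd q j \<in> c j}) ` ?F)"] fin by auto
  let ?W = "topspace ?Q \<inter> \<Inter>(set l)"
  have "set l \<subseteq> ?S" unfolding l using b(1) c by auto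
  then have "?W \<in> boxes X J B \<C>" unfolding boxes_def by (intro imageI) auto
  moreover have "q \<in> ?W"
  proof -
    have "q \<in> topspace ?Q" using G openin_subset by blast
    moreover have "f j \<in> c j" if "j \<in> ?F" for j using that c by blast
    ultimately show ?thesis unfolding l q using b(2) by auto
  qed
  moreover have "?W \<subseteq> G"
  proof
    fix r assume r: "r \<in> ?W"
    have rQ: "fst r \<in> topspace X" "snd r \<in> (\<Pi>\<^sub>E j\<in>J. cube)" using r unfolding topspace_tower_space by auto
    have "fst r \<in> U" using r l b(3) by auto
    moreover have "snd r \<in> Pi\<^sub>E J T"
    proof (rule PiE_I)
      show "snd r j = undefined" if "j \<notin> J" for j using rQ(2) that by (auto simp: PiE_iff extensional_def)
      show "snd r j \<in> T j" if j: "j \<in> J" for j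
      proof (cases "T j = cube")
        case True
        then show ?thesis using rQ(2) j by (auto simp: PiE_iff)
      next
        case False
        then have "{q. snd q j \<in> c j} \<in> set l" unfolding l using j by blast
        then have "snd r j \<in> c j" using r by blast
        moreover have "snd r j \<in> cube" using rQ(2) j by (auto simp: PiE_iff)
        ultimately show ?thesis using c[OF j] by blast
      qed
    qed
    ultimately have "(fst r, snd r) \<in> G" using T(4) UV(5) by blast
    then show "r \<in> G" by simp
  qed
  ultimately show "\<exists>W\<in>boxes X J B \<C>. q \<in> W \<and> W \<subseteq> G" by blast
qed

text \<open>A box restricts finitely many coordinates, so some stage lies beyond all of
  them.\<close>

lemma indep_boxes:
  assumes W: "W \<in> boxes X J B \<C>"
  shows "\<exists>n. indep X J st n W"
proof -
  let ?Q = "tower_space X J"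
  let ?S = "(\<lambda>b. {q. fst q \<in> b}) ` B \<union> (\<Union>j\<in>J. (\<lambda>c. {q. snd q j \<in> c}) ` \<C>)"
  have upd: "set_coord j q t \<in> topspace ?Q" if "j \<in> J" "q \<in> topspace ?Q" "t \<in> cube" for j q t
    using coordinate.upd_in[OF coordinate_tower_space[OF that(1)] that(2,3)] .
  have S: "\<exists>n. \<forall>j\<in>J. n \<le> st j \<longrightarrow> (\<forall>q t. set_coord j q t \<in> s \<longleftrightarrow> q \<in> s)" if "s \<in> ?S" for s
    using that
  proof
    assume "s \<in> (\<lambda>b. {q. fst q \<in> b}) ` B"
    then show ?thesis unfolding set_coord_def by auto
  next
    assume "s \<in> (\<Union>j\<in>J. (\<lambda>c. {q. snd q j \<in> c}) ` \<C>)"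
    then obtain k c where k: "s = {q. snd q k \<in> c}" by auto
    \<comment> \<open>The successor excludes \<open>k\<close> itself along with all coordinates of
      its stage.\<close>
    have "\<forall>j\<in>J. Suc (st k) \<le> st j \<longrightarrow> (\<forall>q t. set_coord j q t \<in> s \<longleftrightarrow> q \<in> s)"
      unfolding set_coord_def k by auto
    then show ?thesis by blast
  qed
  obtain l where l: "W = topspace ?Q \<inter> \<Inter>(set l)" "set l \<subseteq> ?S" using W unfolding boxes_def lists_eq_set by blast
  have "\<exists>n. \<forall>j\<in>J. n \<le> st j \<longrightarrow> (\<forall>q t. set_coord j q t \<in> \<Inter>(set l) \<longleftrightarrow> q \<in> \<Inter>(set l))" using l(2)
  proof (induction l)
    case (Cons s l)
    then obtain n where n: "\<forall>j\<in>J. n \<le> st j \<longrightarrow> (\<forall>q t. set_coord j q t \<in> \<Inter>(set l) \<longleftrightarrow> q \<in> \<Inter>(set l))" by auto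
    have "s \<in> ?S" using Cons.prems by simp
    from S[OF this] obtain n' where n': "\<forall>j\<in>J. n' \<le> st j \<longrightarrow> (\<forall>q t. set_coord j q t \<in> s \<longleftrightarrow> q \<in> s)"
      by (elim exE)
    have "\<forall>j\<in>J. max n n' \<le> st j \<longrightarrow> (\<forall>q t. set_coord j q t \<in> \<Inter>(set (s # l)) \<longleftrightarrow> q \<in> \<Inter>(set (s # l)))"
      using n n' by simp
    then show ?case by blast
  qed simp
  then obtain n where n: "\<And>j q t. j \<in> J \<Longrightarrow> n \<le> st j \<Longrightarrow> set_coord j q t \<in> \<Inter>(set l) \<longleftrightarrow> q \<in> \<Inter>(set l)" by blast
  have "coordinate.invariant ?Q (set_coord j) W" if "j \<in> J" "n \<le> st j" for j
    unfolding coordinate.invariant_def[OF coordinate_tower_space[OF that(1)]] l(1)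
    using n[OF that] upd[OF that(1)] by auto
  then show ?thesis unfolding indep_def by blast
qed

section \<open>The construction\<close>

text \<open>Boxes depend on the index set, while the equations must be indexed by boxes. The circle
  is broken by cardinality: \<open>J\<close> is fixed by size alone, its boxes number at most
  \<open>D\<close>, and a surjection from \<open>D\<close> then assigns every possible request to an
  index.\<close>

lemma rich_tower_preimage:
  fixes X :: "'a topology" and B :: "'a set set"
  assumes X: "continuum X" and ab: "a \<in> topspace X" "b \<in> topspace X" "a \<noteq> b" and B: "open_base X B"
  obtains Y :: "('a \<times> (nat \<times> ('a set + nat) \<Rightarrow> nat \<Rightarrow> real)) topology" and \<E>
  where "continuum Y" "hereditarily_indecomposable Y" "covering_dim_eq Y 1" "weakly_confluent Y X fst"
    "open_base Y \<E>" "|\<E>| \<le>o |B <+> (UNIV :: nat set)|"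
proof -
  define D where "D = B <+> (UNIV :: nat set)"
  \<comment> \<open>The first component is the stage and the second a code for a request, so every
    request is available at every stage.\<close>
  define J :: "(nat \<times> ('a set + nat)) set" where "J = UNIV \<times> D"
  have D: "infinite D" unfolding D_def by simp
  have nat: "|UNIV :: nat set| \<le>o |D|" using D infinite_iff_card_of_nat by blast
  have JD: "|J| \<le>o |D|"
    unfolding J_def by (rule card_of_Times_ordLeq_infinite[OF D nat card_of_mono1[OF subset_refl]])
  obtain \<C> :: "(nat \<Rightarrow> real) set set" where \<C>: "countable \<C>" "topological_basis \<C>"
    using ex_countable_basis by blast
  have "|\<C>| \<le>o |UNIV :: nat set|" by (rule card_of_ordLeqI[OF inj_on_to_nat_on[OF \<C>(1)]]) simp
  then have CD: "|\<C>| \<le>o |D|" using nat ordLeq_transitive by blast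
  define \<B> where "\<B> = boxes X J B \<C>"
  have BD: "|\<B>| \<le>o |D|"
    unfolding \<B>_def by (rule boxes_card[OF D _ JD CD]) (simp add: D_def card_of_Plus1)
  let ?Q = "tower_space X J"
  have base: "open_base ?Q \<B>" unfolding \<B>_def by (rule open_base_boxes[OF B \<C>(2)])
  have "|UNIV :: bool set| \<le>o |UNIV :: nat set|" by (rule card_of_ordLeqI[of of_bool]) (auto simp: inj_on_def)
  then have le: "|(UNIV :: bool set) \<times> lists \<B>| \<le>o |D|"
    by (intro card_of_Times_ordLeq_infinite[OF D] card_of_lists_ordLeq_infinite[OF D BD] ordLeq_transitive[OF _ nat])
  have "(UNIV :: bool set) \<times> lists \<B> \<noteq> {}" by auto
  then have "\<exists>d. d ` D = (UNIV :: bool set) \<times> lists \<B>" using le by (rule iffD2[OF card_of_ordLeq2])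
  then obtain d where d: "d ` D = (UNIV :: bool set) \<times> lists \<B>" by (elim exE)
  \<comment> \<open>A trivial cover by one set, whose equation pins the coordinate to vertex 0. It
    fills the indices whose request is inadmissible.\<close>
  define triv :: "'a \<times> (nat \<times> ('a set + nat) \<Rightarrow> nat \<Rightarrow> real) \<Rightarrow> (nat \<Rightarrow> real) \<Rightarrow> bool"
    where "triv = cover_graph (\<lambda>_. topspace ?Q) 1"
  \<comment> \<open>A request is honoured only at a stage where all its boxes are already determined
    by earlier coordinates. The Boolean flag distinguishes folds from covers.\<close>
  define ok where "ok j \<longleftrightarrow> (\<forall>W\<in>set (snd (d (snd j))). indep X J fst (fst j) W)" for j
  define zz where "zz j \<longleftrightarrow> ok j \<and> fst (d (snd j)) \<and> length (snd (d (snd j))) = 2 \<and>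
      ?Q closure_of (snd (d (snd j)) ! 0) \<inter> ?Q closure_of (snd (d (snd j)) ! 1) = {}" for j
  define cc where "cc j \<longleftrightarrow> ok j \<and> \<not> fst (d (snd j)) \<and> topspace ?Q \<subseteq> \<Union>(set (snd (d (snd j))))" for j
  define R where "R j =
      (if zz j then zigzag ?Q (snd (d (snd j)) ! 0) (snd (d (snd j)) ! 1)
       else if cc j then cover_graph (\<lambda>i. ?Q closure_of (snd (d (snd j)) ! i)) (length (snd (d (snd j))))
       else triv)" for j
  \<comment> \<open>No request is lost: a finite list of boxes is determined from some stage
    \<open>n\<close> on, and \<open>J\<close> contains its code at that stage.\<close>
  have ex: "\<exists>j\<in>J. d (snd j) = (flag, l) \<and> ok j" if l: "set l \<subseteq> \<B>" for flag l
  proof -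
    have "\<exists>n. \<forall>W\<in>set l. indep X J fst n W" using l
    proof (induction l)
      case (Cons W l)
      then obtain n where n: "\<forall>W\<in>set l. indep X J fst n W" by auto
      have "W \<in> boxes X J B \<C>" using Cons.prems unfolding \<B>_def by simp
      from indep_boxes[OF this, of fst] obtain n' where n': "indep X J fst n' W" by (elim exE)
      have "\<forall>W\<in>set (W # l). indep X J fst (max n n') W"
        using n n' indep_mono[of X J fst] by (metis max.cobounded1 max.cobounded2 set_ConsD)
      then show ?case by blast
    qed simp
    then obtain n where n: "\<forall>W\<in>set l. indep X J fst n W" by blast
    have "(flag, l) \<in> d ` D" unfolding d using l by auto
    then obtain \<delta> where \<delta>: "\<delta> \<in> D" "d \<delta> = (flag, l)" by auto
    then show ?thesis
      using n by (intro bexI[of _ "(n, \<delta>)"]) (auto simp: ok_def J_def)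
  qed
  have dl: "set (snd (d (snd j))) \<subseteq> \<B>" if "j \<in> J" for j
  proof -
    have "d (snd j) \<in> d ` D" using that unfolding J_def by auto
    then have "d (snd j) \<in> (UNIV :: bool set) \<times> lists \<B>" unfolding d .
    then show ?thesis by (auto simp: mem_Times_iff)
  qed
  interpret rich_tower X J fst R \<B>
  proof
    show "continuum X" by (rule X)
    show "open_base ?Q \<B>" by (rule base)
  next
    fix j assume j: "j \<in> J"
    let ?l = "snd (d (snd j))"
    consider "zz j" | "\<not> zz j" "cc j" | "\<not> zz j" "\<not> cc j" by blast
    then show "(\<exists>U V. R j = zigzag ?Q U V \<and> openin ?Q U \<and> openin ?Q V \<and>
         indep X J fst (fst j) U \<and> indep X J fst (fst j) V \<and> ?Q closure_of U \<inter> ?Q closure_of V = {}) \<or>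
      (\<exists>F m. R j = cover_graph F m \<and> topspace ?Q \<subseteq> (\<Union>i<m. F i) \<and>
         (\<forall>i<m. closedin ?Q (F i) \<and> indep X J fst (fst j) (F i)))"
    proof cases
      case 1
      then have "?l ! 0 \<in> set ?l" "?l ! 1 \<in> set ?l" unfolding zz_def by auto
      then have "openin ?Q (?l ! 0)" "openin ?Q (?l ! 1)" "indep X J fst (fst j) (?l ! 0)" "indep X J fst (fst j) (?l ! 1)"
        using 1 dl[OF j] open_baseD(1)[OF base] unfolding zz_def ok_def by blast+
      then show ?thesis
        using 1 by (intro disjI1 exI[of _ "?l ! 0"] exI[of _ "?l ! 1"]) (simp add: R_def zz_def)
    next
      case 2
      have in_l: "?l ! i \<in> \<B> \<and> indep X J fst (fst j) (?l ! i)" if "i < length ?l" for i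
        using 2(2) dl[OF j] nth_mem[OF that] unfolding cc_def ok_def by blast
      have "topspace ?Q \<subseteq> (\<Union>i<length ?l. ?Q closure_of (?l ! i))"
      proof
        fix q assume "q \<in> topspace ?Q"
        then obtain W where "W \<in> set ?l" "q \<in> W" using 2(2) unfolding cc_def by blast
        then obtain i where i: "i < length ?l" "q \<in> ?l ! i" by (metis in_set_conv_nth)
        then have "q \<in> ?Q closure_of (?l ! i)"
          using in_l[OF i(1)] open_baseD(1)[OF base] closure_of_subset openin_subset by (metis subsetD)
        then show "q \<in> (\<Union>i<length ?l. ?Q closure_of (?l ! i))" using i(1) by blast
      qed
      moreover have "closedin ?Q (?Q closure_of (?l ! i)) \<and> indep X J fst (fst j) (?Q closure_of (?l ! i))"
        if "i < length ?l" for i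
        using indep_closure[OF conjunct2[OF in_l[OF that]]] by simp
      ultimately show ?thesis
        using 2 by (intro disjI2 exI[of _ "\<lambda>i. ?Q closure_of (?l ! i)"] exI[of _ "length ?l"]) (simp add: R_def)
    next
      case 3
      have "indep X J fst (fst j) (topspace ?Q)"
        unfolding indep_def
      proof (intro ballI impI)
        fix k assume k: "k \<in> J"
        show "coordinate.invariant ?Q (set_coord k) (topspace ?Q)"
          unfolding coordinate.invariant_def[OF coordinate_tower_space[OF k]]
          using coordinate.upd_in[OF coordinate_tower_space[OF k]] by blast
      qed
      then show ?thesis
        using 3 by (intro disjI2 exI[of _ "\<lambda>_. topspace ?Q"] exI[of _ 1]) (simp add: R_def triv_def lessThan_Suc)
    qed
  next
    fix U V assume UV: "U \<in> \<B>" "V \<in> \<B>" "?Q closure_of U \<inter> ?Q closure_of V = {}"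
    then obtain j where j: "j \<in> J" "d (snd j) = (True, [U, V])" "ok j" using ex[of "[U, V]" True] by auto
    then have "R j = zigzag ?Q U V" using UV(3) by (simp add: R_def zz_def)
    then show "\<exists>j\<in>J. R j = zigzag ?Q U V" using j(1) by blast
  next
    fix \<F> assume F: "finite \<F>" "\<F> \<subseteq> \<B>" "topspace ?Q \<subseteq> \<Union>\<F>"
    obtain l where l: "set l = \<F>" using finite_list[OF F(1)] by (elim exE)
    then obtain j where j: "j \<in> J" "d (snd j) = (False, l)" "ok j" using ex[of l False] F(2) by auto
    have "R j = cover_graph (\<lambda>i. ?Q closure_of (l ! i)) (length l)"
      using j l F(3) by (simp add: R_def zz_def cc_def)
    moreover have "(\<lambda>i. l ! i) ` {..<length l} = \<F>" using l by (auto simp: set_conv_nth)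
    ultimately show "\<exists>j\<in>J. \<exists>m W. W ` {..<m} = \<F> \<and> R j = cover_graph (\<lambda>i. ?Q closure_of W i) m"
      using j(1) by (intro bexI[of _ j] exI[of _ "length l"] exI[of _ "\<lambda>i. l ! i"]) auto
  qed
  obtain C where C: "closedin ?Q C" "continuum (subtopology ?Q C)" "hereditarily_indecomposable (subtopology ?Q C)"
    "covering_dim_eq (subtopology ?Q C) 1" "weakly_confluent (subtopology ?Q C) X fst"
    by (rule hereditarily_indecomposable_preimage[OF ab])
  have "open_base (subtopology ?Q C) ((\<lambda>W. W \<inter> C) ` \<B>)"
  proof (rule open_baseI)
    show "openin (subtopology ?Q C) W" if "W \<in> (\<lambda>W. W \<inter> C) ` \<B>" for W
      using that open_baseD(1)[OF base] by (auto simp: openin_subtopology)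
    fix G q assume "openin (subtopology ?Q C) G" "q \<in> G"
    then obtain G' where G': "openin ?Q G'" "G = G' \<inter> C" "q \<in> G'" "q \<in> C" by (auto simp: openin_subtopology)
    from open_baseD(2)[OF base G'(1,3)] obtain W where W: "W \<in> \<B>" "q \<in> W" "W \<subseteq> G'" by blast
    then have "q \<in> W \<inter> C" "W \<inter> C \<subseteq> G" using G'(2,4) by auto
    then show "\<exists>W\<in>(\<lambda>W. W \<inter> C) ` \<B>. q \<in> W \<and> W \<subseteq> G"
      using W(1) by (intro bexI[of _ "W \<inter> C"] conjI imageI)
  qed
  moreover have "|(\<lambda>W. W \<inter> C) ` \<B>| \<le>o |B <+> (UNIV :: nat set)|"
    using card_of_image_ordLeq[OF BD] unfolding D_def .
  ultimately show thesis by (rule that[OF C(2-5)])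
qed

section \<open>Transport along homeomorphisms and choice of the carrier type\<close>

lemma subcontinuum_image:
  assumes "continuous_map Y Y' h" "subcontinuum Y A"
  shows "subcontinuum Y' (h ` A)"
  using assms continuous_map_image_subset_topspace[OF assms(1)] image_compactin[OF _ assms(1)]
    connectedin_continuous_map_image[OF assms(1)]
  unfolding subcontinuum_def by (auto 0 3)

lemma covering_dim_le_homeomorphic:
  assumes hk: "homeomorphic_maps Y Y' h k" and dim: "covering_dim_le Y n"
  shows "covering_dim_le Y' n"
  unfolding covering_dim_le_def
proof (intro allI impI; elim conjE)
  have h: "continuous_map Y Y' h" and k: "continuous_map Y' Y k"
    and kh: "\<And>y. y \<in> topspace Y \<Longrightarrow> k (h y) = y" and hk': "\<And>z. z \<in> topspace Y' \<Longrightarrow> h (k z) = z"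
    using hk unfolding homeomorphic_maps_def by auto
  have hin: "h y \<in> topspace Y'" if "y \<in> topspace Y" for y
    using h that continuous_map_image_subset_topspace by fastforce
  have kin: "k z \<in> topspace Y" if "z \<in> topspace Y'" for z
    using k that continuous_map_image_subset_topspace by fastforce
  fix \<U> assume \<U>: "finite \<U>" "\<forall>U\<in>\<U>. openin Y' U" "\<Union>\<U> = topspace Y'"
  let ?U = "(\<lambda>U. {y \<in> topspace Y. h y \<in> U}) ` \<U>"
  have o: "openin Y U" if "U \<in> ?U" for U
    using that \<U>(2) openin_continuous_map_preimage[OF h] by blast
  have fin: "finite ?U" using \<U>(1) by blast
  have un: "\<Union>?U = topspace Y" using \<U>(3) hin by auto
  obtain \<V> where \<V>: "finite \<V>" "\<And>V. V \<in> \<V> \<Longrightarrow> openin Y V" "\<Union>\<V> = topspace Y"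
      "\<And>V. V \<in> \<V> \<Longrightarrow> \<exists>U\<in>?U. V \<subseteq> U" "\<And>x. x \<in> topspace Y \<Longrightarrow> card {V \<in> \<V>. x \<in> V} \<le> n + 1"
    by (rule covering_dim_leE[OF dim fin o un]) (assumption | rule that)+
  let ?g = "\<lambda>V. {z \<in> topspace Y'. k z \<in> V}"
  have "finite (?g ` \<V>)" using \<V>(1) by blast
  moreover have "\<forall>V\<in>?g ` \<V>. openin Y' V"
    using \<V>(2) openin_continuous_map_preimage[OF k] by blast
  moreover have "\<Union>(?g ` \<V>) = topspace Y'" using \<V>(3) kin by auto
  moreover have "\<forall>V\<in>?g ` \<V>. \<exists>U\<in>\<U>. V \<subseteq> U"
  proof
    fix V' assume "V' \<in> ?g ` \<V>"
    then obtain V where V: "V \<in> \<V>" "V' = ?g V" by blast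
    from \<V>(4)[OF V(1)] obtain U where U: "U \<in> \<U>" "V \<subseteq> {y \<in> topspace Y. h y \<in> U}" by blast
    have "V' \<subseteq> U"
    proof
      fix z assume "z \<in> V'"
      then have "z \<in> topspace Y'" "h (k z) \<in> U" using V(2) U(2) by auto
      then show "z \<in> U" using hk' by simp
    qed
    then show "\<exists>U\<in>\<U>. V' \<subseteq> U" using U(1) by blast
  qed
  moreover have "card {V \<in> ?g ` \<V>. z \<in> V} \<le> n + 1" if z: "z \<in> topspace Y'" for z
  proof -
    have "{V \<in> ?g ` \<V>. z \<in> V} \<subseteq> ?g ` {V \<in> \<V>. k z \<in> V}" by auto
    then have "card {V \<in> ?g ` \<V>. z \<in> V} \<le> card (?g ` {V \<in> \<V>. k z \<in> V})"
      by (rule card_mono[rotated]) (simp add: \<V>(1))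
    also have "\<dots> \<le> card {V \<in> \<V>. k z \<in> V}" by (rule card_image_le) (simp add: \<V>(1))
    also have "\<dots> \<le> n + 1" using \<V>(5)[OF kin[OF z]] .
    finally show ?thesis .
  qed
  ultimately show "\<exists>\<V>. finite \<V> \<and> (\<forall>V\<in>\<V>. openin Y' V) \<and> \<Union>\<V> = topspace Y' \<and>
      (\<forall>V\<in>\<V>. \<exists>U\<in>\<U>. V \<subseteq> U) \<and> (\<forall>x\<in>topspace Y'. card {V \<in> \<V>. x \<in> V} \<le> n + 1)"
    by (intro exI[of _ "?g ` \<V>"] conjI ballI) auto
qed

lemma hereditarily_indecomposable_homeomorphic:
  assumes hk: "homeomorphic_maps Y Y' h k" and hi: "hereditarily_indecomposable Y"
  shows "hereditarily_indecomposable Y'"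
  unfolding hereditarily_indecomposable_def
proof (intro conjI allI impI)
  have sp: "Y homeomorphic_space Y'" using hk homeomorphic_maps_imp_homeomorphic_space by blast
  show "compact_space Y'" "Hausdorff_space Y'"
    using hi homeomorphic_compact_space[OF sp] homeomorphic_Hausdorff_space[OF sp]
    unfolding hereditarily_indecomposable_def by auto
  have k: "continuous_map Y' Y k" and hk': "\<And>z. z \<in> topspace Y' \<Longrightarrow> h (k z) = z"
    using hk unfolding homeomorphic_maps_def by auto
  fix A B assume AB: "subcontinuum Y' A \<and> subcontinuum Y' B \<and> A \<inter> B \<noteq> {}"
  then have "subcontinuum Y (k ` A)" "subcontinuum Y (k ` B)" "k ` A \<inter> k ` B \<noteq> {}"
    using subcontinuum_image[OF k] by auto
  then have "k ` A \<subseteq> k ` B \<or> k ` B \<subseteq> k ` A" using hi unfolding hereditarily_indecomposable_def by simp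
  then have "h ` k ` A \<subseteq> h ` k ` B \<or> h ` k ` B \<subseteq> h ` k ` A" by (meson image_mono)
  moreover have "h ` k ` S = S" if "subcontinuum Y' S" for S
    using that hk' unfolding subcontinuum_def by (force simp: image_image)
  ultimately show "A \<subseteq> B \<or> B \<subseteq> A" using AB by simp
qed

text \<open>A point of a Hausdorff space is determined by the basic sets containing it. Coding basic
  sets by elements of \<open>'u\<close> turns points into subsets of \<open>'u\<close>, and the
  topology is pulled back along the inverse.\<close>

lemma homeomorphic_copy_on_sets:
  fixes Y :: "'t topology"
  assumes Y: "Hausdorff_space Y" and E: "open_base Y \<E>" "|\<E>| \<le>o |UNIV :: 'u set|"
  obtains Y' :: "'u set topology" and h k where "homeomorphic_maps Y Y' h k"
proof -
  obtain g :: "'t set \<Rightarrow> 'u" where g: "inj_on g \<E>" using E(2) unfolding card_of_ordLeq[symmetric] by blast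
  define h where "h y = g ` {W \<in> \<E>. y \<in> W}" for y
  define k where "k = inv_into (topspace Y) h"
  have inj: "inj_on h (topspace Y)"
  proof (rule inj_onI, rule ccontr)
    fix x y assume xy: "x \<in> topspace Y" "y \<in> topspace Y" "h x = h y" "x \<noteq> y"
    have "openin Y (topspace Y - {y})" "x \<in> topspace Y - {y}"
      using xy Y by (auto simp: closedin_Hausdorff_singleton)
    from open_baseD(2)[OF E(1) this] obtain W where W: "W \<in> \<E>" "x \<in> W" "y \<notin> W" by blast
    then have "g W \<in> h y" using xy(3) unfolding h_def by blast
    then obtain W' where "W' \<in> \<E>" "y \<in> W'" "g W = g W'" unfolding h_def by blast
    then show False using g W by (auto simp: inj_on_def)
  qed
  define Y' where "Y' = pullback_topology (h ` topspace Y) k Y"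
  have kh: "k (h y) = y" if "y \<in> topspace Y" for y unfolding k_def using inj that by simp
  have top: "topspace Y' = h ` topspace Y" unfolding Y'_def topspace_pullback_topology using kh by auto
  have "continuous_map Y' Y k" unfolding Y'_def using continuous_map_pullback[OF continuous_map_id] by simp
  moreover have "continuous_map Y Y' h"
    unfolding continuous_map_def
  proof (intro conjI allI impI)
    show "h \<in> topspace Y \<rightarrow> topspace Y'" using top by auto
    fix U assume "openin Y' U"
    then obtain W where W: "openin Y W" "U = k -` W \<inter> h ` topspace Y" unfolding Y'_def openin_pullback_topology by blast
    then have "{y \<in> topspace Y. h y \<in> U} = W" using kh openin_subset[OF W(1)] by auto
    then show "openin Y {y \<in> topspace Y. h y \<in> U}" using W(1) by simp
  qed
  ultimately have "homeomorphic_maps Y Y' h k" unfolding homeomorphic_maps_def using kh top by auto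
  then show thesis by (rule that)
qed

lemma card_of_Plus_nat_ordLeq:
  assumes "infinite D" "|A| \<le>o |D|"
  shows "|A <+> (UNIV :: nat set)| \<le>o |D|"
proof -
  have "A <+> (UNIV :: nat set) = Inl ` A \<union> Inr ` UNIV" by auto
  moreover have "|UNIV :: nat set| \<le>o |D|" using assms(1) infinite_iff_card_of_nat by blast
  ultimately show ?thesis
    using card_of_Un_ordLeq_infinite[OF assms(1)] card_of_image_ordLeq assms(2) by metis
qed

text \<open>The weight of \<open>X\<close> is bounded by that of the copy because \<open>X\<close>
  is its continuous image. The reverse bound comes from \<open>\<E>\<close>, which is small against
  every base of \<open>X\<close>.\<close>

lemma weakly_confluent_preimage_on_sets:
  fixes X :: "'a topology" and Y :: "'t topology"
  assumes X: "Hausdorff_space X" and Y: "continuum Y" "hereditarily_indecomposable Y" "covering_dim_eq Y 1"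
    and wc: "weakly_confluent Y X f" and E: "open_base Y \<E>" "|\<E>| \<le>o |UNIV :: 'u set|"
    and small: "\<And>B'. open_base X B' \<Longrightarrow> |\<E>| \<le>o |B' <+> (UNIV :: nat set)|"
  shows "\<exists>(Y' :: 'u set topology) f'. continuum Y' \<and> hereditarily_indecomposable Y' \<and> covering_dim_eq Y' 1 \<and>
    same_weight Y' X \<and> weakly_confluent Y' X f'"
proof -
  have YY: "topspace Y \<noteq> {}" "compact_space Y" "connected_space Y" "Hausdorff_space Y"
    using Y(1) unfolding continuum_def by auto
  obtain Y' :: "'u set topology" and h k where hk: "homeomorphic_maps Y Y' h k"
    by (rule homeomorphic_copy_on_sets[OF YY(4) E])
  have h: "continuous_map Y Y' h" and k: "continuous_map Y' Y k"
    and kh: "\<And>y. y \<in> topspace Y \<Longrightarrow> k (h y) = y" and hk': "\<And>z. z \<in> topspace Y' \<Longrightarrow> h (k z) = z"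
    using hk unfolding homeomorphic_maps_def by auto
  have him: "h ` topspace Y = topspace Y'" and kim: "k ` topspace Y' = topspace Y"
  proof -
    have "h ` topspace Y \<subseteq> topspace Y'" "k ` topspace Y' \<subseteq> topspace Y"
      by (rule continuous_map_image_subset_topspace[OF h] continuous_map_image_subset_topspace[OF k])+
    moreover have "z \<in> h ` topspace Y" if "z \<in> topspace Y'" for z
      using calculation(2) that by (intro image_eqI[of z h "k z"]) (auto simp: hk')
    moreover have "y \<in> k ` topspace Y'" if "y \<in> topspace Y" for y
      using calculation(1) that by (intro image_eqI[of y k "h y"]) (auto simp: kh)
    ultimately show "h ` topspace Y = topspace Y'" "k ` topspace Y' = topspace Y" by blast+
  qed
  have sp: "Y homeomorphic_space Y'" using hk homeomorphic_maps_imp_homeomorphic_space by blast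
  have 1: "continuum Y'"
    using YY him homeomorphic_compact_space[OF sp] homeomorphic_Hausdorff_space[OF sp] homeomorphic_connected_space[OF sp]
    unfolding continuum_def by auto
  have kh_sym: "homeomorphic_maps Y' Y k h" using hk homeomorphic_maps_sym by blast
  have 3: "covering_dim_eq Y' 1"
    using Y(3) covering_dim_le_homeomorphic[OF hk] covering_dim_le_homeomorphic[OF kh_sym]
    unfolding covering_dim_eq_def by blast
  have f: "continuous_map Y X f" "f ` topspace Y = topspace X"
    and lift: "\<And>K. subcontinuum X K \<Longrightarrow> \<exists>L. subcontinuum Y L \<and> f ` L = K"
    using wc unfolding weakly_confluent_def by auto
  have fk: "continuous_map Y' X (f \<circ> k)" using continuous_map_compose[OF k f(1)] .
  have fkim: "(f \<circ> k) ` topspace Y' = topspace X" using kim f(2) by (metis image_comp)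
  have 5: "weakly_confluent Y' X (f \<circ> k)"
    unfolding weakly_confluent_def
  proof (intro conjI fk fkim allI impI)
    fix K assume "subcontinuum X K"
    from lift[OF this] obtain L where L: "subcontinuum Y L" "f ` L = K" by blast
    have "L \<subseteq> topspace Y" using L(1) unfolding subcontinuum_def by blast
    then have "(f \<circ> k) ` h ` L = f ` L"
      unfolding image_image by (intro image_cong) (auto simp: kh)
    then have "(f \<circ> k) ` h ` L = K" using L(2) by simp
    then show "\<exists>L. subcontinuum Y' L \<and> (f \<circ> k) ` L = K" using subcontinuum_image[OF h L(1)] by blast
  qed
  have "weight_le X Y'"
    using weight_le_continuous_image[OF _ X fk fkim] 1 unfolding continuum_def by blast
  moreover have "weight_le Y' X"
    unfolding weight_le_def
  proof (intro allI impI)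
    fix B' assume B': "open_base X B'"
    have "weight_le Y' Y"
      using weight_le_continuous_image[OF YY(2) _ h him] 1 unfolding continuum_def by blast
    then obtain \<C> where C: "open_base Y' \<C>" "|\<C>| \<le>o |\<E> <+> (UNIV :: nat set)|"
      using E(1) unfolding weight_le_def by blast
    have "|\<E> <+> (UNIV :: nat set)| \<le>o |B' <+> (UNIV :: nat set)|"
      by (rule card_of_Plus_nat_ordLeq[OF _ small[OF B']]) simp
    then show "\<exists>\<C>. open_base Y' \<C> \<and> |\<C>| \<le>o |B' <+> (UNIV :: nat set)|"
      using C ordLeq_transitive by blast
  qed
  ultimately have 4: "same_weight Y' X" unfolding same_weight_def by blast
  show ?thesis using 1 hereditarily_indecomposable_homeomorphic[OF hk Y(2)] 3 4 5 by blast
qed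

theorem theorem4p4:
  fixes X :: "'a topology"
  assumes "continuum X"
  shows "\<exists>(Y :: ('a + nat) set topology) f.
           continuum Y \<and> hereditarily_indecomposable Y \<and> covering_dim_eq Y 1 \<and>
           same_weight Y X \<and> weakly_confluent Y X f"
proof -
  have X: "topspace X \<noteq> {}" "compact_space X" "connected_space X" "Hausdorff_space X"
    using assms unfolding continuum_def by auto
  have inf: "infinite (UNIV :: ('a + nat) set)" by simp
  show ?thesis
  proof (cases "\<exists>a b. a \<in> topspace X \<and> b \<in> topspace X \<and> a \<noteq> b")
    case True
    then obtain a b where ab: "a \<in> topspace X" "b \<in> topspace X" "a \<noteq> b" by blast
    \<comment> \<open>Starting from a base of least size makes the base of \<open>Y\<close> small
      against every base of \<open>X\<close>, and also small enough for the required carrier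
      type.\<close>
    obtain B where B: "open_base X B" "|B| \<le>o |UNIV :: ('a + nat) set|" "\<And>B'. open_base X B' \<Longrightarrow> |B| \<le>o |B'|"
      by (rule minimal_open_base[OF X(2,4)]) (assumption | rule that)+
    obtain Y :: "('a \<times> (nat \<times> ('a set + nat) \<Rightarrow> nat \<Rightarrow> real)) topology" and \<E>
      where Y: "continuum Y" "hereditarily_indecomposable Y" "covering_dim_eq Y 1" "weakly_confluent Y X fst"
        "open_base Y \<E>" "|\<E>| \<le>o |B <+> (UNIV :: nat set)|"
      by (rule rich_tower_preimage[OF assms ab B(1)])
    have "|\<E>| \<le>o |UNIV :: ('a + nat) set|"
      by (rule ordLeq_transitive[OF Y(6) card_of_Plus_nat_ordLeq[OF inf B(2)]])
    moreover have "|\<E>| \<le>o |B' <+> (UNIV :: nat set)|" if "open_base X B'" for B'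
      by (rule ordLeq_transitive[OF Y(6) card_of_Plus_mono1[OF B(3)[OF that]]])
    ultimately show ?thesis by (rule weakly_confluent_preimage_on_sets[OF X(4) Y(1-5)])
  next
    case False
    then obtain x where x: "topspace X = {x}" using X(1) by blast
    \<comment> \<open>A tower over one point could have a degenerate component of dimension 0, so a
      nondegenerate continuum with a countable base takes its place.\<close>
    let ?I = "top_of_set {0..1::real}"
    have I: "continuum ?I"
      unfolding continuum_def by (auto simp: compact_space_subtopology connected_space_subtopology Hausdorff_space_subtopology)
    obtain \<C> :: "real set set" where \<C>: "countable \<C>" "topological_basis \<C>"
      using ex_countable_basis by blast
    define B where "B = (\<lambda>c. {0..1} \<inter> c) ` \<C>"
    have B: "open_base ?I B"
    proof (rule open_baseI)
      show "openin ?I W" if "W \<in> B" for W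
        using that topological_basis_open[OF \<C>(2)] unfolding B_def by (auto simp: openin_open)
      fix G q assume "openin ?I G" "q \<in> G"
      then obtain S where S: "open S" "G = {0..1} \<inter> S" unfolding openin_open by blast
      then have "q \<in> S" using \<open>q \<in> G\<close> by blast
      then obtain c where "c \<in> \<C>" "q \<in> c" "c \<subseteq> S" using topological_basisE[OF \<C>(2) S(1)] by blast
      then show "\<exists>W\<in>B. q \<in> W \<and> W \<subseteq> G" unfolding B_def using S(2) \<open>q \<in> G\<close> by auto
    qed
    have "countable B" unfolding B_def using \<C>(1) by blast
    then have "|B| \<le>o |UNIV :: nat set|" by (rule card_of_ordLeqI[OF inj_on_to_nat_on]) simp
    then have Bn: "|B <+> (UNIV :: nat set)| \<le>o |UNIV :: nat set|"
      by (intro card_of_Plus_nat_ordLeq) simp_all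
    obtain Y :: "(real \<times> (nat \<times> (real set + nat) \<Rightarrow> nat \<Rightarrow> real)) topology" and \<E>
      where Y: "continuum Y" "hereditarily_indecomposable Y" "covering_dim_eq Y 1" "weakly_confluent Y ?I fst"
        "open_base Y \<E>" "|\<E>| \<le>o |B <+> (UNIV :: nat set)|"
      by (rule rich_tower_preimage[OF I _ _ _ B, of 0 1]) auto
    \<comment> \<open>The base of \<open>Y\<close> is countable. Since weight is counted from
      \<open>aleph_0\<close> upwards, this matches the weight of the one-point space.\<close>
    have En: "|\<E>| \<le>o |D|" if "infinite D" for D :: "'d set"
      using ordLeq_transitive[OF ordLeq_transitive[OF Y(6) Bn]] that infinite_iff_card_of_nat by blast
    have YY: "topspace Y \<noteq> {}" "compact_space Y" "connected_space Y" using Y(1) unfolding continuum_def by auto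
    have Ysub: "subcontinuum Y (topspace Y)"
      unfolding subcontinuum_def using YY by (auto simp: connectedin_topspace compact_space_def)
    have const: "(\<lambda>_. x) ` topspace Y = {x}" using YY(1) by (metis ex_in_conv image_constant)
    have "weakly_confluent Y X (\<lambda>_. x)"
      unfolding weakly_confluent_def
    proof (intro conjI allI impI)
      show "continuous_map Y X (\<lambda>_. x)" using x by simp
      show "(\<lambda>_. x) ` topspace Y = topspace X" unfolding x by (rule const)
      fix K assume "subcontinuum X K"
      then have "K = {x}" unfolding subcontinuum_def x by blast
      then show "\<exists>L. subcontinuum Y L \<and> (\<lambda>_. x) ` L = K"
        using Ysub const by blast
    qed
    moreover have "|\<E>| \<le>o |B' <+> (UNIV :: nat set)|" for B' :: "'a set set"
      by (rule En) simp
    ultimately show ?thesis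
      using weakly_confluent_preimage_on_sets[OF X(4) Y(1-3) _ Y(5) En[OF inf]] by blast
  qed
qed

end
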